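(* Let $\lambda>0$, $\Gamma>0$, $a>0$ be real numbers with $\lambda>6\max\{\Gamma,1/a\}$, and let $p\in L^1(\mathbb{R})\cap C(\mathbb{R})$ satisfy $|\widehat p(\xi)|\le\Gamma e^{-a|\xi|}$ for all $\xi\in\mathbb{R}$. Then there exists a solution $\sigma\in L^2(\mathbb{R})\cap C^\infty(\mathbb{R})$, with $\widehat\sigma\in L^1(\mathbb{R})$, of the band-limited integral equation $$\sigma(x)=S[T_b\sigma](x)+p(x)\quad\text{for all }x\in\mathbb{R},$$ such that $$|\widehat\sigma(\xi)|\le2\Gamma\exp\!\left(-\left(a-\frac1\lambda\right)|\xi|\right)\quad\text{for all }\xi\in\mathbb{R}.$$
   Context: Fourier transform convention: $\widehat f(\xi)=\int f(x)e^{-ix\xi}dx$, inverse $\frac1{2\pi}\int\widehat f(\xi)e^{ix\xi}d\xi$. Fix an infinitely differentiable $b:\mathbb{R}\to[0,1]$ with $b(\xi)=1$ for $|\xi|\le\lambda$ and $b(\xi)=0$ for $|\xi|\ge\sqrt2\lambda$. For $f$ with integrable Fourier transform, $T_bf(x)=\frac1{2\pi}\int_{\mathbb{R}}e^{ix\xi}\widehat f(\xi)\frac{b(\xi)}{4\lambda^2-\xi^2}d\xi$. For $f\in C^1(\mathbb{R})$, $S[f](x)=\frac14(f'(x))^2-4\lambda^2\left(e^{f(x)}-1-f(x)\right)$. *)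

theory Defs
  imports "HOL-Analysis.Analysis"
begin

definition fourier :: "(real \<Rightarrow> complex) \<Rightarrow> real \<Rightarrow> complex" where
  "fourier f \<xi> = (LINT x|lborel. f x * cis (- (x * \<xi>)))"

definition inv_fourier :: "(real \<Rightarrow> complex) \<Rightarrow> real \<Rightarrow> complex" where
  "inv_fourier g x = (LINT \<xi>|lborel. g \<xi> * cis (x * \<xi>)) / complex_of_real (2 * pi)"

definition C_inf :: "(real \<Rightarrow> 'a::real_normed_vector) \<Rightarrow> bool" where
  "C_inf f \<longleftrightarrow> (\<exists>D. D 0 = f \<and> (\<forall>n x. (D n has_vector_derivative D (Suc n) x) (at x)))"

definition L2 :: "(real \<Rightarrow> complex) \<Rightarrow> bool" where
  "L2 f \<longleftrightarrow> f \<in> borel_measurable lborel \<and> integrable lborel (\<lambda>x. (cmod (f x))\<^sup>2)"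

text \<open>The operator T_b, expressed through the Fourier transform fh of its argument:
  T_b f (x) = (1/(2 pi)) int e^{i x xi} fh(xi) b(xi)/(4 lam^2 - xi^2) d xi.\<close>
definition Tb_hat :: "real \<Rightarrow> (real \<Rightarrow> real) \<Rightarrow> (real \<Rightarrow> complex) \<Rightarrow> real \<Rightarrow> complex" where
  "Tb_hat lam b fh x = inv_fourier (\<lambda>\<xi>. fh \<xi> * complex_of_real (b \<xi> / (4 * lam\<^sup>2 - \<xi>\<^sup>2))) x"

definition S_op :: "real \<Rightarrow> (real \<Rightarrow> complex) \<Rightarrow> real \<Rightarrow> complex" where
  "S_op lam f x = (vector_derivative f (at x))\<^sup>2 / 4 - 4 * complex_of_real (lam\<^sup>2) * (exp (f x) - 1 - f x)"

end

theory Submission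
  imports Defs "HOL-Probability.Characteristic_Functions" "HOL-Probability.Sinc_Integral"
    "HOL-Real_Asymp.Real_Asymp"
begin

text \<open>On the Fourier side the equation is a fixed-point problem \<open>h = p_hat + S_hat h\<close>:
  \<open>T\<^sub>b\<close> multiplies \<open>h\<close> by \<open>b \<xi> / (4 \<lambda>\<^sup>2 - \<xi>\<^sup>2)\<close>, which vanishes for \<open>\<bar>\<xi>\<bar> \<ge> sqrt 2 \<lambda>\<close> and is
  at most \<open>1 / (2 \<lambda>\<^sup>2)\<close>; products become convolutions divided by \<open>2 pi\<close>, so \<open>e\<^sup>u - 1 - u\<close>
  becomes a series of convolution powers. Convolving with a function supported in \<open>[-R, R]\<close> and
  bounded by \<open>B exp (- c \<bar>\<xi>\<bar>)\<close> costs a factor \<open>2 R B\<close> in the weighted sup norm, so for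
  \<open>\<lambda> > 6 max \<Gamma> (1 / a)\<close> the map preserves the functions bounded by
  \<open>2 \<Gamma> exp (- (a - 1 / \<lambda>) \<bar>\<xi>\<bar>)\<close> and halves weighted distances between them; its iterates
  from \<open>0\<close> converge to a fixed point. The inverse transform \<open>\<sigma>\<close> of the fixed point solves the
  equation by Fourier inversion of \<open>p\<close>; it is smooth because all moments of its transform are
  finite, and square integrable by a Gaussian-regularised Plancherel estimate.\<close>

section \<open>Integrals on the real line\<close>

lemma borel_measurable_cis [measurable (raw)]:
  "f \<in> borel_measurable M \<Longrightarrow> (\<lambda>x. cis (f x)) \<in> borel_measurable M"
  using measurable_compose borel_measurable_continuous_onI[OF continuous_on_cis[OF continuous_on_id]]
  by blast

lemma borel_measurable_cnj [measurable (raw)]: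
  "f \<in> borel_measurable M \<Longrightarrow> (\<lambda>x. cnj (f x)) \<in> borel_measurable M"
  using measurable_compose borel_measurable_continuous_onI[OF continuous_on_cnj[OF continuous_on_id]]
  by blast

lemma lborel_integrable_translate_iff:
  fixes f :: "real \<Rightarrow> 'a::{banach, second_countable_topology}"
  shows "integrable lborel (\<lambda>x. f (x - t)) \<longleftrightarrow> integrable lborel f"
  using lborel_integrable_real_affine_iff[of 1 f "-t"] by simp

lemma lborel_integral_translate:
  fixes f :: "real \<Rightarrow> 'a::{banach, second_countable_topology}"
  shows "(LINT x|lborel. f (x - t)) = (LINT x|lborel. f x)"
  using lborel_integral_real_affine[of 1 f "-t"] by simp

lemma lborel_integrable_reflect_iff:
  fixes f :: "real \<Rightarrow> 'a::{banach, second_countable_topology}"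
  shows "integrable lborel (\<lambda>x. f (t - x)) \<longleftrightarrow> integrable lborel f"
  using lborel_integrable_real_affine_iff[of "-1" f t] by simp

lemma lborel_integral_reflect:
  fixes f :: "real \<Rightarrow> 'a::{banach, second_countable_topology}"
  shows "(LINT x|lborel. f (t - x)) = (LINT x|lborel. f x)"
  using lborel_integral_real_affine[of "-1" f t] by simp

lemma integral_dominated_convergence_at_within:
  fixes s :: "'b::first_countable_topology \<Rightarrow> 'a \<Rightarrow> 'c::{banach, second_countable_topology}"
  assumes "f \<in> borel_measurable M" and "\<And>t. s t \<in> borel_measurable M" and "integrable M w"
    and "\<And>t. t \<in> S - {a} \<Longrightarrow> AE x in M. norm (s t x) \<le> w x"
    and "AE x in M. ((\<lambda>t. s t x) \<longlongrightarrow> f x) (at a within S)"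
  shows "((\<lambda>t. integral\<^sup>L M (s t)) \<longlongrightarrow> integral\<^sup>L M f) (at a within S)"
  unfolding tendsto_at_iff_sequentially o_def
proof (intro allI impI)
  fix X :: "nat \<Rightarrow> 'b" assume X: "\<forall>i. X i \<in> S - {a}" and "X \<longlonglongrightarrow> a"
  then have "\<And>x. ((\<lambda>t. s t x) \<longlongrightarrow> f x) (at a within S) \<Longrightarrow> (\<lambda>i. s (X i) x) \<longlonglongrightarrow> f x"
    by (auto simp: tendsto_at_iff_sequentially o_def)
  with assms(5) have "AE x in M. (\<lambda>i. s (X i) x) \<longlonglongrightarrow> f x"
    by (auto elim: AE_mp)
  moreover have "AE x in M. norm (s (X i) x) \<le> w x" for i
    using X assms(4) by blast
  ultimately show "(\<lambda>i. integral\<^sup>L M (s (X i))) \<longlonglongrightarrow> integral\<^sup>L M f"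
    using assms(1-3) by (rule integral_dominated_convergence[rotated 3])
qed

lemma integrable_power_exp_neg_halfline:
  assumes "c > 0"
  shows "integrable lborel (\<lambda>x::real. x ^ k * exp (- c * x) * indicator {0..} x)"
proof -
  have "integrable lborel (\<lambda>x::real. x ^ k * exp (- x) * indicator {0..} x)"
    using has_bochner_integral_I0i_power_exp_m' by (rule integrable.intros)
  then have "integrable lborel (\<lambda>x::real. (1 / c ^ k) * ((c * x) ^ k * exp (- (c * x)) * indicator {0..} (c * x)))"
    using lborel_integrable_real_affine_iff[of c "\<lambda>x::real. x ^ k * exp (- x) * indicator {0..} x" 0] assms
    by simp
  also have "(\<lambda>x::real. (1 / c ^ k) * ((c * x) ^ k * exp (- (c * x)) * indicator {0..} (c * x)))
      = (\<lambda>x. x ^ k * exp (- c * x) * indicator {0..} x)"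
    using assms by (auto simp: fun_eq_iff power_mult_distrib indicator_def zero_le_mult_iff)
  finally show ?thesis .
qed

lemma integrable_abs_power_exp_neg_abs:
  assumes "c > 0"
  shows "integrable lborel (\<lambda>x::real. \<bar>x\<bar> ^ k * exp (- c * \<bar>x\<bar>))"
proof -
  define g where "g x = x ^ k * exp (- c * x) * indicator {0..} x" for x :: real
  have "integrable lborel g"
    unfolding g_def using assms by (rule integrable_power_exp_neg_halfline)
  moreover have "integrable lborel (\<lambda>x. g (0 - x))"
    using calculation by (simp only: lborel_integrable_reflect_iff)
  ultimately have "integrable lborel (\<lambda>x. g x + g (0 - x))" by simp
  then show ?thesis
  proof (rule Bochner_Integration.integrable_bound)
    show "(\<lambda>x. \<bar>x\<bar> ^ k * exp (- c * \<bar>x\<bar>)) \<in> borel_measurable lborel" by measurable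
    show "AE x in lborel. norm (\<bar>x\<bar> ^ k * exp (- c * \<bar>x\<bar>)) \<le> norm (g x + g (0 - x))"
      by (intro AE_I2) (cases "x \<ge> 0"; cases "x = 0"; simp add: g_def indicator_def)
  qed
qed

lemma integrable_exp_neg_abs:
  "c > 0 \<Longrightarrow> integrable lborel (\<lambda>x::real. exp (- c * \<bar>x\<bar>))"
  using integrable_abs_power_exp_neg_abs[of c 0] by simp

lemma integrable_gaussian:
  assumes "e > 0"
  shows "integrable lborel (\<lambda>x::real. exp (- e * x\<^sup>2))"
proof -
  have bound: "exp (- e * x\<^sup>2) \<le> exp (1 / (4 * e)) * exp (- \<bar>x\<bar>)" for x :: real
  proof -
    have sq: "\<bar>x\<bar>\<^sup>2 = x\<^sup>2" by simp
    have "e * x\<^sup>2 - \<bar>x\<bar> + 1 / (4 * e) = (e * \<bar>x\<bar> - 1/2)\<^sup>2 / e"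
      using assms unfolding sq[symmetric] by (simp add: field_simps power2_eq_square)
    also have "\<dots> \<ge> 0" using assms by simp
    finally have "- e * x\<^sup>2 \<le> 1 / (4 * e) + - \<bar>x\<bar>" by simp
    then show ?thesis by (metis exp_add exp_le_cancel_iff)
  qed
  have "integrable lborel (\<lambda>x::real. exp (1 / (4 * e)) * exp (- \<bar>x\<bar>))"
    using integrable_exp_neg_abs[of 1] by simp
  then show ?thesis
    by (rule Bochner_Integration.integrable_bound) (use bound in auto)
qed

section \<open>The Gauss kernel and Fourier inversion\<close>

definition gauss_kernel :: "real \<Rightarrow> real \<Rightarrow> real" where
  "gauss_kernel e s = sqrt (pi / e) * exp (- s\<^sup>2 / (4 * e))"

lemma gaussian_fourier:
  assumes "e > 0"
  shows "(LINT \<xi>|lborel. complex_of_real (exp (- e * \<xi>\<^sup>2)) * cis (s * \<xi>))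
    = complex_of_real (gauss_kernel e s)"
proof -
  define c where "c = sqrt (2 * e)"
  have c0: "c > 0" and cc: "c\<^sup>2 = 2 * e" using assms by (simp_all add: c_def)
  define t where "t = s / c"
  have "(LINT x|lborel. std_normal_density x *\<^sub>R iexp (t * x)) = char std_normal_distribution t"
    unfolding char_def by (subst integral_density) (auto simp: normal_density_nonneg)
  also have "\<dots> = complex_of_real (exp (- t\<^sup>2 / 2))"
    by (simp add: char_std_normal_distribution)
  finally have char: "(LINT x|lborel. std_normal_density x *\<^sub>R iexp (t * x)) = complex_of_real (exp (- t\<^sup>2 / 2))" .
  have "std_normal_density (0 + c * \<xi>) *\<^sub>R iexp (t * (0 + c * \<xi>))
      = (1 / sqrt (2 * pi)) *\<^sub>R (complex_of_real (exp (- e * \<xi>\<^sup>2)) * cis (s * \<xi>))" for \<xi>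
  proof -
    have "- (c * \<xi>)\<^sup>2 / 2 = - e * \<xi>\<^sup>2" using cc by (simp add: power_mult_distrib)
    moreover have "iexp (t * (0 + c * \<xi>)) = cis (s * \<xi>)"
      using c0 by (simp add: t_def cis_conv_exp)
    ultimately show ?thesis
      unfolding std_normal_density_def by (simp add: scaleR_conv_of_real mult.commute)
  qed
  then have "(LINT x|lborel. std_normal_density x *\<^sub>R iexp (t * x))
      = (c / sqrt (2 * pi)) *\<^sub>R (LINT \<xi>|lborel. complex_of_real (exp (- e * \<xi>\<^sup>2)) * cis (s * \<xi>))"
    using lborel_integral_real_affine[of c "\<lambda>x. std_normal_density x *\<^sub>R iexp (t * x)" 0] c0 by simp
  then have "(LINT \<xi>|lborel. complex_of_real (exp (- e * \<xi>\<^sup>2)) * cis (s * \<xi>))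
      = (sqrt (2 * pi) / c) *\<^sub>R (LINT x|lborel. std_normal_density x *\<^sub>R iexp (t * x))"
    using c0 by simp
  also note char
  also have "sqrt (2 * pi) / c = sqrt (pi / e)"
    using assms by (simp add: c_def real_sqrt_divide[symmetric])
  also have "- t\<^sup>2 / 2 = - s\<^sup>2 / (4 * e)"
    using cc c0 assms by (simp add: t_def power_divide)
  finally show ?thesis by (simp add: scaleR_conv_of_real gauss_kernel_def)
qed

lemma gaussian_integral:
  assumes "e > 0"
  shows "(LINT x|lborel. exp (- e * x\<^sup>2)) = sqrt (pi / e)"
proof -
  have "complex_of_real (LINT x|lborel. exp (- e * x\<^sup>2))
      = (LINT x|lborel. complex_of_real (exp (- e * x\<^sup>2)) * cis (0 * x))"
    by (simp add: integral_complex_of_real)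
  also have "\<dots> = complex_of_real (sqrt (pi / e))"
    using gaussian_fourier[OF assms, of 0] by (simp add: gauss_kernel_def)
  finally show ?thesis by simp
qed

lemma gauss_kernel_nonneg: "e > 0 \<Longrightarrow> gauss_kernel e s \<ge> 0"
  by (simp add: gauss_kernel_def)

lemma gauss_kernel_le: "e > 0 \<Longrightarrow> gauss_kernel e s \<le> sqrt (pi / e)"
  by (simp add: gauss_kernel_def)

lemma gauss_kernel_measurable [measurable (raw)]:
  "f \<in> borel_measurable M \<Longrightarrow> (\<lambda>x. gauss_kernel e (f x)) \<in> borel_measurable M"
  unfolding gauss_kernel_def
  by (intro borel_measurable_times borel_measurable_exp borel_measurable_divide
      borel_measurable_uminus borel_measurable_power) auto

lemma gauss_kernel_eq: "e > 0 \<Longrightarrow> gauss_kernel e s = sqrt (pi / e) * exp (- (1 / (4 * e)) * s\<^sup>2)"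
  by (simp add: gauss_kernel_def)

lemma integrable_gauss_kernel:
  assumes "e > 0"
  shows "integrable lborel (\<lambda>y. gauss_kernel e (x - y))"
proof -
  have "integrable lborel (\<lambda>s. sqrt (pi / e) * exp (- (1 / (4 * e)) * s\<^sup>2))"
    using integrable_gaussian[of "1 / (4 * e)"] assms by simp
  also have "(\<lambda>s. sqrt (pi / e) * exp (- (1 / (4 * e)) * s\<^sup>2)) = gauss_kernel e"
    using gauss_kernel_eq[OF assms] by auto
  finally show ?thesis by (simp add: lborel_integrable_reflect_iff)
qed

lemma integral_gauss_kernel:
  assumes "e > 0"
  shows "(LINT y|lborel. gauss_kernel e (x - y)) = 2 * pi"
proof -
  have "(LINT y|lborel. gauss_kernel e (x - y)) = (LINT s|lborel. gauss_kernel e s)"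
    by (rule lborel_integral_reflect)
  also have "\<dots> = sqrt (pi / e) * (LINT s|lborel. exp (- (1 / (4 * e)) * s\<^sup>2))"
    by (simp only: gauss_kernel_eq[OF assms] integral_mult_right_zero)
  also have "\<dots> = sqrt (pi / e) * sqrt (pi / (1 / (4 * e)))"
    using gaussian_integral[of "1 / (4 * e)"] assms by simp
  also have "\<dots> = sqrt ((2 * pi)\<^sup>2)"
    using assms by (simp add: real_sqrt_mult[symmetric] field_simps power2_eq_square)
  also have "\<dots> = 2 * pi" by (rule real_sqrt_unique) auto
  finally show ?thesis .
qed

lemma gauss_kernel_tail_le:
  assumes "e > 0" "0 \<le> d" "d \<le> \<bar>s\<bar>"
  shows "gauss_kernel e s \<le> sqrt (pi / e) * exp (- d\<^sup>2 / (4 * e))"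
    and "gauss_kernel e s \<le> sqrt (pi / e) * exp (- d\<^sup>2 / (8 * e)) * exp (- (1 / (8 * e)) * s\<^sup>2)"
proof -
  have "d\<^sup>2 \<le> s\<^sup>2" using assms by (metis power2_abs power_mono)
  then have "exp (- s\<^sup>2 / (4 * e)) \<le> exp (- d\<^sup>2 / (4 * e))"
    and "exp (- s\<^sup>2 / (4 * e)) \<le> exp (- d\<^sup>2 / (8 * e)) * exp (- (1 / (8 * e)) * s\<^sup>2)"
    using assms by (simp_all add: field_simps flip: exp_add)
  then show "gauss_kernel e s \<le> sqrt (pi / e) * exp (- d\<^sup>2 / (4 * e))"
    and "gauss_kernel e s \<le> sqrt (pi / e) * exp (- d\<^sup>2 / (8 * e)) * exp (- (1 / (8 * e)) * s\<^sup>2)"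
    unfolding gauss_kernel_def mult.assoc using assms(1) by (auto intro!: mult_left_mono)
qed

lemma fourier_measurable [measurable]:
  assumes [measurable]: "f \<in> borel_measurable lborel"
  shows "fourier f \<in> borel_measurable borel"
  unfolding fourier_def[abs_def] by measurable

lemma inv_fourier_measurable [measurable]:
  assumes [measurable]: "f \<in> borel_measurable lborel"
  shows "inv_fourier f \<in> borel_measurable borel"
  unfolding inv_fourier_def[abs_def] by measurable

lemma integral_fourier_cis_gaussian:
  fixes f :: "real \<Rightarrow> complex"
  assumes f: "integrable lborel f" and e: "e > 0"
  shows "(LINT \<xi>|lborel. fourier f \<xi> * cis (x * \<xi>) * complex_of_real (exp (- e * \<xi>\<^sup>2)))
       = (LINT y|lborel. f y * complex_of_real (gauss_kernel e (x - y)))"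
proof -
  have [measurable]: "f \<in> borel_measurable lborel" using f by auto
  define F where "F \<xi> y = f y * cis (- (y * \<xi>)) * cis (x * \<xi>) * complex_of_real (exp (- e * \<xi>\<^sup>2))" for \<xi> y
  have norm_F: "norm (F \<xi> y) = norm (f y) * exp (- e * \<xi>\<^sup>2)" for \<xi> y
    by (simp add: F_def norm_mult)
  have F_integrable: "integrable (lborel \<Otimes>\<^sub>M lborel) (\<lambda>(\<xi>, y). F \<xi> y)"
  proof (rule lborel_pair.Fubini_integrable)
    show "(\<lambda>(\<xi>, y). F \<xi> y) \<in> borel_measurable (lborel \<Otimes>\<^sub>M lborel)"
      unfolding F_def by measurable
    have "integrable lborel (\<lambda>\<xi>. exp (- e * \<xi>\<^sup>2) * (LINT y|lborel. norm (f y)))"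
      using integrable_gaussian[OF e] by simp
    then show "integrable lborel (\<lambda>\<xi>. LINT y|lborel. norm (case (\<xi>, y) of (\<xi>, y) \<Rightarrow> F \<xi> y))"
      by (simp add: norm_F mult.commute)
    have "integrable lborel (\<lambda>y. F \<xi> y)" for \<xi>
    proof (rule Bochner_Integration.integrable_bound)
      show "integrable lborel (\<lambda>y. norm (f y) * exp (- e * \<xi>\<^sup>2))" using f by simp
      show "(\<lambda>y. F \<xi> y) \<in> borel_measurable lborel" unfolding F_def by measurable
    qed (simp add: norm_F)
    then show "AE \<xi> in lborel. integrable lborel (\<lambda>y. case (\<xi>, y) of (\<xi>, y) \<Rightarrow> F \<xi> y)"
      by simp
  qed
  have inner: "(LINT \<xi>|lborel. F \<xi> y) = f y * complex_of_real (gauss_kernel e (x - y))" for y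
  proof -
    have "(LINT \<xi>|lborel. F \<xi> y)
        = f y * (LINT \<xi>|lborel. complex_of_real (exp (- e * \<xi>\<^sup>2)) * cis ((x - y) * \<xi>))"
      unfolding F_def integral_mult_right_zero[symmetric]
      by (intro Bochner_Integration.integral_cong refl) (simp add: cis_mult algebra_simps)
    then show ?thesis using gaussian_fourier[OF e, of "x - y"] by simp
  qed
  have "(LINT \<xi>|lborel. fourier f \<xi> * cis (x * \<xi>) * complex_of_real (exp (- e * \<xi>\<^sup>2)))
      = (LINT \<xi>|lborel. LINT y|lborel. F \<xi> y)"
    unfolding fourier_def F_def by (simp add: integral_mult_left_zero)
  also have "\<dots> = (LINT y|lborel. LINT \<xi>|lborel. F \<xi> y)"
    using lborel_pair.Fubini_integral[OF F_integrable] by simp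
  finally show ?thesis by (simp add: inner)
qed

lemma gauss_kernel_split_le:
  fixes f :: "real \<Rightarrow> complex"
  assumes e: "e > 0" and "0 \<le> d" "0 \<le> \<eta>" and near: "\<bar>x - y\<bar> < d \<Longrightarrow> norm (f y - f x) \<le> \<eta>"
  shows "norm ((f y - f x) * complex_of_real (gauss_kernel e (x - y)))
    \<le> \<eta> * gauss_kernel e (x - y) + norm (f y) * (sqrt (pi / e) * exp (- d\<^sup>2 / (4 * e)))
      + norm (f x) * (sqrt (pi / e) * exp (- d\<^sup>2 / (8 * e)) * exp (- (1 / (8 * e)) * (x - y)\<^sup>2))"
    (is "_ \<le> \<eta> * ?G + norm (f y) * ?s + norm (f x) * ?K")
proof -
  have G: "?G \<ge> 0" using e by (rule gauss_kernel_nonneg)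
  have "0 \<le> norm (f y) * ?s + norm (f x) * ?K" "0 \<le> \<eta> * ?G"
    using e G \<open>0 \<le> \<eta>\<close> by simp_all
  moreover have "norm (f y - f x) * ?G \<le> \<eta> * ?G" if "\<bar>x - y\<bar> < d"
    using near[OF that] G by (simp add: mult_right_mono)
  moreover have "norm (f y - f x) * ?G \<le> norm (f y) * ?s + norm (f x) * ?K" if "\<not> \<bar>x - y\<bar> < d"
  proof -
    have "?G \<le> ?s" "?G \<le> ?K"
      using gauss_kernel_tail_le[OF e \<open>0 \<le> d\<close>, of "x - y"] that by simp_all
    then have "norm (f y) * ?G + norm (f x) * ?G \<le> norm (f y) * ?s + norm (f x) * ?K"
      by (intro add_mono mult_left_mono) simp_all
    moreover have "norm (f y - f x) * ?G \<le> norm (f y) * ?G + norm (f x) * ?G"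
      using mult_right_mono[OF norm_triangle_ineq4 G] by (simp add: distrib_right)
    ultimately show ?thesis by linarith
  qed
  ultimately show ?thesis using G by (simp add: norm_mult) linarith
qed

lemma gauss_kernel_conv_estimate:
  fixes f :: "real \<Rightarrow> complex"
  assumes f: "integrable lborel f" and e: "e > 0" and "0 \<le> d" and "0 \<le> \<eta>"
    and near: "\<And>y. \<bar>x - y\<bar> < d \<Longrightarrow> norm (f y - f x) \<le> \<eta>"
  shows "norm ((LINT y|lborel. f y * complex_of_real (gauss_kernel e (x - y))) - 2 * pi * f x)
    \<le> 2 * pi * \<eta> + (LINT y|lborel. norm (f y)) * (sqrt (pi / e) * exp (- d\<^sup>2 / (4 * e)))
      + norm (f x) * (sqrt (pi / e) * exp (- d\<^sup>2 / (8 * e)) * sqrt (8 * pi * e))"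
proof -
  have [measurable]: "f \<in> borel_measurable lborel" using f by auto
  define s where "s = sqrt (pi / e) * exp (- d\<^sup>2 / (4 * e))"
  define K where "K t = sqrt (pi / e) * exp (- d\<^sup>2 / (8 * e)) * exp (- (1 / (8 * e)) * t\<^sup>2)" for t
  have "integrable lborel K" and "(LINT t|lborel. K t) = sqrt (pi / e) * exp (- d\<^sup>2 / (8 * e)) * sqrt (8 * pi * e)"
    unfolding K_def using integrable_gaussian[of "1 / (8 * e)"] gaussian_integral[of "1 / (8 * e)"] e
    by auto
  then have K: "integrable lborel (\<lambda>y. K (x - y))"
    "(LINT y|lborel. K (x - y)) = sqrt (pi / e) * exp (- d\<^sup>2 / (8 * e)) * sqrt (8 * pi * e)"
    by (simp_all add: lborel_integrable_reflect_iff lborel_integral_reflect)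
  define B where "B y = \<eta> * gauss_kernel e (x - y) + norm (f y) * s + norm (f x) * K (x - y)" for y
  have B: "integrable lborel B"
    unfolding B_def using integrable_gauss_kernel[OF e] f K(1) by auto
  have G: "integrable lborel (\<lambda>y. complex_of_real (gauss_kernel e (x - y)))"
    using integrable_gauss_kernel[OF e] by (rule integrable_of_real)
  have fG: "integrable lborel (\<lambda>y. f y * complex_of_real (gauss_kernel e (x - y)))"
  proof (rule Bochner_Integration.integrable_bound)
    show "integrable lborel (\<lambda>y. norm (f y) * sqrt (pi / e))" using f by simp
    show "AE y in lborel. norm (f y * complex_of_real (gauss_kernel e (x - y))) \<le> norm (norm (f y) * sqrt (pi / e))"
      using e by (intro AE_I2) (simp add: norm_mult gauss_kernel_nonneg gauss_kernel_le mult_left_mono)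
  qed measurable
  have "(LINT y|lborel. f y * complex_of_real (gauss_kernel e (x - y))) - 2 * pi * f x
      = (LINT y|lborel. (f y - f x) * complex_of_real (gauss_kernel e (x - y)))"
    using integral_gauss_kernel[OF e, of x] fG G
    by (simp add: left_diff_distrib integral_complex_of_real[symmetric] mult.commute)
  also have "norm \<dots> \<le> (LINT y|lborel. B y)"
  proof (intro order.trans[OF integral_norm_bound] integral_mono)
    show "norm ((f y - f x) * complex_of_real (gauss_kernel e (x - y))) \<le> B y" for y
      using gauss_kernel_split_le[OF e \<open>0 \<le> d\<close> \<open>0 \<le> \<eta>\<close> near[of y]] by (simp only: B_def s_def K_def)
  qed (use B fG G in \<open>auto simp: left_diff_distrib\<close>)
  also have "\<dots> = 2 * pi * \<eta> + (LINT y|lborel. norm (f y)) * s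
      + norm (f x) * (sqrt (pi / e) * exp (- d\<^sup>2 / (8 * e)) * sqrt (8 * pi * e))"
    unfolding B_def using integrable_gauss_kernel[OF e] integral_gauss_kernel[OF e] f K
    by (simp add: mult.commute)
  finally show ?thesis unfolding s_def .
qed

lemma gauss_kernel_conv_tendsto:
  fixes f :: "real \<Rightarrow> complex"
  assumes f: "integrable lborel f" and cont: "isCont f x"
  shows "((\<lambda>e. LINT y|lborel. f y * complex_of_real (gauss_kernel e (x - y))) \<longlongrightarrow> 2 * pi * f x)
    (at_right 0)"
proof (rule tendstoI)
  fix r :: real assume "r > 0"
  define \<eta> where "\<eta> = r / (4 * pi)"
  have "\<eta> > 0" using \<open>r > 0\<close> by (simp add: \<eta>_def)
  then obtain d where "d > 0" and d: "\<And>y. dist y x < d \<Longrightarrow> dist (f y) (f x) < \<eta>"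
    using cont unfolding continuous_at_eps_delta by blast
  have near: "norm (f y - f x) \<le> \<eta>" if "\<bar>x - y\<bar> < d" for y
    using d[of y] that by (simp add: dist_norm abs_minus_commute)
  define L where "L = (LINT y|lborel. norm (f y))"
  have A: "((\<lambda>e. sqrt (pi / e) * exp (- d\<^sup>2 / (4 * e))) \<longlongrightarrow> 0) (at_right 0)"
    and B: "((\<lambda>e. sqrt (pi / e) * exp (- d\<^sup>2 / (8 * e)) * sqrt (8 * pi * e)) \<longlongrightarrow> 0) (at_right 0)"
    using \<open>d > 0\<close> by real_asymp+
  have "((\<lambda>e. L * (sqrt (pi / e) * exp (- d\<^sup>2 / (4 * e)))
      + norm (f x) * (sqrt (pi / e) * exp (- d\<^sup>2 / (8 * e)) * sqrt (8 * pi * e))) \<longlongrightarrow> 0) (at_right 0)"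
    using tendsto_add_zero[OF tendsto_mult_right_zero[OF A] tendsto_mult_right_zero[OF B]] .
  then have "eventually (\<lambda>e. L * (sqrt (pi / e) * exp (- d\<^sup>2 / (4 * e)))
      + norm (f x) * (sqrt (pi / e) * exp (- d\<^sup>2 / (8 * e)) * sqrt (8 * pi * e)) < r / 2) (at_right 0)"
    by (rule order_tendstoD(2)) (use \<open>r > 0\<close> in simp)
  moreover have "eventually (\<lambda>e. e > 0) (at_right (0::real))"
    by (rule eventually_at_right_less)
  ultimately show "eventually (\<lambda>e. dist (LINT y|lborel. f y * complex_of_real (gauss_kernel e (x - y)))
      (2 * pi * f x) < r) (at_right 0)"
  proof eventually_elim
    case (elim e)
    have "2 * pi * \<eta> = r / 2" by (simp add: \<eta>_def)
    then show ?case
      using gauss_kernel_conv_estimate[OF f \<open>e > 0\<close> less_imp_le[OF \<open>d > 0\<close>] less_imp_le[OF \<open>\<eta> > 0\<close>] near]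
        elim(1)
      by (simp add: dist_norm L_def)
  qed
qed

theorem fourier_inversion:
  fixes f :: "real \<Rightarrow> complex"
  assumes f: "integrable lborel f" and cont: "isCont f x" and F: "integrable lborel (fourier f)"
  shows "inv_fourier (fourier f) x = f x"
proof -
  have [measurable]: "f \<in> borel_measurable lborel" using f by auto
  define I where "I e = (LINT \<xi>|lborel. fourier f \<xi> * cis (x * \<xi>) * complex_of_real (exp (- e * \<xi>\<^sup>2)))"
    for e
  have "(I \<longlongrightarrow> (LINT \<xi>|lborel. fourier f \<xi> * cis (x * \<xi>) * complex_of_real (exp (- 0 * \<xi>\<^sup>2))))
      (at_right 0)"
    unfolding I_def
  proof (rule integral_dominated_convergence_at_within[where w = "\<lambda>\<xi>. norm (fourier f \<xi>)"])
    show "integrable lborel (\<lambda>\<xi>. norm (fourier f \<xi>))" using F by simp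
    show "AE \<xi> in lborel. norm (fourier f \<xi> * cis (x * \<xi>) * complex_of_real (exp (- e * \<xi>\<^sup>2)))
        \<le> norm (fourier f \<xi>)" if "e \<in> {0<..} - {0}" for e
      using that by (intro AE_I2) (simp add: norm_mult mult_left_le)
    show "AE \<xi> in lborel. ((\<lambda>e. fourier f \<xi> * cis (x * \<xi>) * complex_of_real (exp (- e * \<xi>\<^sup>2)))
        \<longlongrightarrow> fourier f \<xi> * cis (x * \<xi>) * complex_of_real (exp (- 0 * \<xi>\<^sup>2))) (at_right 0)"
      by (intro AE_I2 tendsto_intros)
  qed measurable
  moreover have "eventually (\<lambda>e. I e = (LINT y|lborel. f y * complex_of_real (gauss_kernel e (x - y))))
      (at_right 0)"
    using eventually_at_right_less by eventually_elim (unfold I_def, rule integral_fourier_cis_gaussian[OF f])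
  then have "(I \<longlongrightarrow> 2 * pi * f x) (at_right 0)"
    by (rule tendsto_cong[THEN iffD2]) (rule gauss_kernel_conv_tendsto[OF f cont])
  ultimately have "(LINT \<xi>|lborel. fourier f \<xi> * cis (x * \<xi>)) = 2 * pi * f x"
    using tendsto_unique[OF trivial_limit_at_right_real] by simp
  then show ?thesis by (simp add: inv_fourier_def)
qed

section \<open>Inverse Fourier transforms: linearity and derivatives\<close>

lemma integrable_mult_cis:
  fixes f :: "real \<Rightarrow> complex"
  shows "integrable lborel f \<Longrightarrow> integrable lborel (\<lambda>\<xi>. f \<xi> * cis (x * \<xi>))"
  by (rule Bochner_Integration.integrable_bound) (auto simp: norm_mult)

lemma inv_fourier_add:
  assumes "integrable lborel f" "integrable lborel g"
  shows "inv_fourier (\<lambda>\<xi>. f \<xi> + g \<xi>) x = inv_fourier f x + inv_fourier g x"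
  unfolding inv_fourier_def using integrable_mult_cis[OF assms(1)] integrable_mult_cis[OF assms(2)]
  by (simp add: distrib_right add_divide_distrib)

lemma inv_fourier_diff:
  assumes "integrable lborel f" "integrable lborel g"
  shows "inv_fourier (\<lambda>\<xi>. f \<xi> - g \<xi>) x = inv_fourier f x - inv_fourier g x"
  unfolding inv_fourier_def using integrable_mult_cis[OF assms(1)] integrable_mult_cis[OF assms(2)]
  by (simp add: left_diff_distrib diff_divide_distrib)

lemma inv_fourier_mult_left: "inv_fourier (\<lambda>\<xi>. c * f \<xi>) x = c * inv_fourier f x"
  unfolding inv_fourier_def by (simp add: mult.assoc)

lemma inv_fourier_divide: "inv_fourier (\<lambda>\<xi>. f \<xi> / c) x = inv_fourier f x / c"
  using inv_fourier_mult_left[of "inverse c" f x] by (simp add: divide_inverse mult.commute)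

lemma inv_fourier_suminf:
  fixes T :: "nat \<Rightarrow> real \<Rightarrow> complex"
  assumes integrable: "\<And>n. integrable lborel (T n)"
    and summable: "\<And>\<xi>. summable (\<lambda>n. norm (T n \<xi>))"
    and summable_integrals: "summable (\<lambda>n. LINT \<xi>|lborel. norm (T n \<xi>))"
  shows "inv_fourier (\<lambda>\<xi>. \<Sum>n. T n \<xi>) x = (\<Sum>n. inv_fourier (T n) x)"
proof -
  define F where "F n \<xi> = T n \<xi> * cis (x * \<xi>)" for n \<xi>
  have norm_F: "norm (F n \<xi>) = norm (T n \<xi>)" for n \<xi> by (simp add: F_def norm_mult)
  have F: "integrable lborel (F n)" for n
    unfolding F_def[abs_def] by (rule integrable_mult_cis[OF integrable])
  have "(LINT \<xi>|lborel. (\<Sum>n. T n \<xi>) * cis (x * \<xi>)) = (LINT \<xi>|lborel. (\<Sum>n. F n \<xi>))"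
    unfolding F_def by (simp add: suminf_mult2[OF summable_norm_cancel[OF summable]])
  also have "\<dots> = (\<Sum>n. LINT \<xi>|lborel. F n \<xi>)"
    by (rule integral_suminf[OF F]) (use summable summable_integrals in \<open>simp_all add: norm_F\<close>)
  finally have "(LINT \<xi>|lborel. (\<Sum>n. T n \<xi>) * cis (x * \<xi>)) = (\<Sum>n. LINT \<xi>|lborel. F n \<xi>)" .
  moreover have "summable (\<lambda>n. LINT \<xi>|lborel. F n \<xi>)"
  proof (rule summable_norm_cancel, rule summable_comparison_test'[OF summable_integrals])
    show "norm (norm (LINT \<xi>|lborel. F n \<xi>)) \<le> (LINT \<xi>|lborel. norm (T n \<xi>))" for n
      using integral_norm_bound[of lborel "F n"] by (simp add: norm_F)
  qed
  ultimately show ?thesis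
    unfolding inv_fourier_def F_def by (simp add: suminf_divide)
qed

lemma norm_inv_fourier_le:
  assumes "integrable lborel h"
  shows "norm (inv_fourier h x) \<le> (LINT \<xi>|lborel. norm (h \<xi>)) / (2 * pi)"
proof -
  have "norm (LINT \<xi>|lborel. h \<xi> * cis (x * \<xi>)) \<le> (LINT \<xi>|lborel. norm (h \<xi> * cis (x * \<xi>)))"
    by (rule integral_norm_bound)
  then show ?thesis unfolding inv_fourier_def by (simp add: norm_mult norm_divide divide_right_mono)
qed

lemma cnj_inv_fourier: "cnj (inv_fourier h x) = inv_fourier (\<lambda>\<xi>. cnj (h (- \<xi>))) x"
proof -
  have "cnj (LINT \<xi>|lborel. h \<xi> * cis (x * \<xi>)) = (LINT \<xi>|lborel. cnj (h \<xi>) * cis (- (x * \<xi>)))"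
    by (simp add: cis_cnj flip: Bochner_Integration.integral_cnj)
  also have "\<dots> = (LINT \<xi>|lborel. cnj (h (- \<xi>)) * cis (x * \<xi>))"
    using lborel_integral_reflect[of "\<lambda>\<xi>. cnj (h \<xi>) * cis (- (x * \<xi>))" 0] by simp
  finally show ?thesis unfolding inv_fourier_def by simp
qed

lemma inv_fourier_eq_fourier: "inv_fourier k x = fourier k (- x) / (2 * pi)"
  unfolding inv_fourier_def fourier_def by (simp add: mult.commute)

lemma norm_cis_minus_one_le: "norm (cis t - 1) \<le> \<bar>t\<bar>"
  using iexp_approx1[of t 0] by (simp add: cis_conv_exp)

lemma norm_cis_minus_linear_le:
  shows "norm (cis t - 1 - \<i> * t) \<le> t\<^sup>2 / 2" and "norm (cis t - 1 - \<i> * t) \<le> 2 * \<bar>t\<bar>"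
proof -
  have "(\<Sum>k\<le>Suc 0. (\<i> * complex_of_real t) ^ k / fact k) = 1 + \<i> * t" by simp
  then show "norm (cis t - 1 - \<i> * t) \<le> t\<^sup>2 / 2"
    using iexp_approx1[of t 1] by (simp add: cis_conv_exp diff_diff_eq power2_eq_square)
  have "norm (cis t - 1 - \<i> * t) \<le> norm (cis t - 1) + norm (\<i> * complex_of_real t)"
    by (rule norm_triangle_ineq4)
  then show "norm (cis t - 1 - \<i> * t) \<le> 2 * \<bar>t\<bar>"
    using norm_cis_minus_one_le[of t] by (simp add: norm_mult)
qed

lemma cis_remainder_integral_tendsto:
  fixes f :: "real \<Rightarrow> complex"
  assumes [measurable]: "f \<in> borel_measurable lborel" and f1: "integrable lborel (\<lambda>\<xi>. \<xi> * f \<xi>)"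
  shows "((\<lambda>h. LINT \<xi>|lborel. norm (f \<xi>) * (norm (cis (h * \<xi>) - 1 - \<i> * complex_of_real (h * \<xi>)) / \<bar>h\<bar>)) \<longlongrightarrow> 0)
    (at 0)"
proof -
  define r where "r h \<xi> = norm (f \<xi>) * (norm (cis (h * \<xi>) - 1 - \<i> * complex_of_real (h * \<xi>)) / \<bar>h\<bar>)" for h \<xi>
  have "((\<lambda>h. LINT \<xi>|lborel. r h \<xi>) \<longlongrightarrow> (LINT (\<xi>::real)|lborel. 0)) (at 0)"
  proof (rule integral_dominated_convergence_at_within[where w = "\<lambda>\<xi>. 2 * norm (complex_of_real \<xi> * f \<xi>)"])
    show "integrable lborel (\<lambda>\<xi>. 2 * norm (\<xi> * f \<xi>))" using f1 by simp
    show "AE \<xi> in lborel. norm (r h \<xi>) \<le> 2 * norm (\<xi> * f \<xi>)" if "h \<in> UNIV - {0}" for h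
    proof (intro AE_I2)
      fix \<xi>
      have "norm (cis (h * \<xi>) - 1 - \<i> * complex_of_real (h * \<xi>)) / \<bar>h\<bar> \<le> 2 * \<bar>\<xi>\<bar>"
        using that norm_cis_minus_linear_le(2)[of "h * \<xi>"] by (simp add: divide_simps abs_mult mult_ac)
      then have "r h \<xi> \<le> norm (f \<xi>) * (2 * \<bar>\<xi>\<bar>)"
        unfolding r_def by (rule mult_left_mono) simp
      then show "norm (r h \<xi>) \<le> 2 * norm (\<xi> * f \<xi>)"
        by (simp add: r_def norm_mult mult_ac)
    qed
    show "AE \<xi> in lborel. ((\<lambda>h. r h \<xi>) \<longlongrightarrow> 0) (at 0)"
    proof (intro AE_I2)
      fix \<xi>
      have "norm (r h \<xi>) \<le> norm (f \<xi>) * (\<xi>\<^sup>2 / 2 * \<bar>h\<bar>)" if "h \<noteq> 0" for h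
      proof -
        have "norm (cis (h * \<xi>) - 1 - \<i> * complex_of_real (h * \<xi>)) / \<bar>h\<bar> \<le> \<xi>\<^sup>2 / 2 * \<bar>h\<bar>"
          using that norm_cis_minus_linear_le(1)[of "h * \<xi>"]
          by (simp add: divide_simps power2_eq_square abs_mult algebra_simps)
        then have "r h \<xi> \<le> norm (f \<xi>) * (\<xi>\<^sup>2 / 2 * \<bar>h\<bar>)"
          unfolding r_def by (rule mult_left_mono) simp
        moreover have "0 \<le> r h \<xi>" by (simp add: r_def)
        ultimately show ?thesis by (simp only: real_norm_def abs_of_nonneg)
      qed
      then have "eventually (\<lambda>h. norm (r h \<xi>) \<le> norm (f \<xi>) * (\<xi>\<^sup>2 / 2 * \<bar>h\<bar>)) (at 0)"
        by (auto simp: eventually_at_filter)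
      moreover have "((\<lambda>h. norm (f \<xi>) * (\<xi>\<^sup>2 / 2 * \<bar>h\<bar>)) \<longlongrightarrow> 0) (at 0)"
        using tendsto_mult_left[OF tendsto_rabs[OF tendsto_ident_at], of "norm (f \<xi>) * (\<xi>\<^sup>2 / 2)" 0 UNIV]
        by (simp add: mult.assoc)
      ultimately show "((\<lambda>h. r h \<xi>) \<longlongrightarrow> 0) (at 0)"
        by (rule Lim_null_comparison)
    qed
  qed (auto simp: r_def)
  then show ?thesis by (simp add: r_def)
qed

lemma inv_fourier_has_vector_derivative:
  fixes f :: "real \<Rightarrow> complex"
  assumes f: "integrable lborel f" and f1: "integrable lborel (\<lambda>\<xi>. \<xi> * f \<xi>)"
  shows "(inv_fourier f has_vector_derivative inv_fourier (\<lambda>\<xi>. \<i> * \<xi> * f \<xi>) x) (at x)"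
proof -
  have [measurable]: "f \<in> borel_measurable lborel" using f by auto
  define F where "F y = (LINT \<xi>|lborel. f \<xi> * cis (y * \<xi>))" for y
  define F' where "F' = (LINT \<xi>|lborel. \<i> * \<xi> * f \<xi> * cis (x * \<xi>))"
  define r where "r h \<xi> = cis (h * \<xi>) - 1 - \<i> * complex_of_real (h * \<xi>)" for h \<xi>
  have F'_integrable: "integrable lborel (\<lambda>\<xi>. \<i> * \<xi> * f \<xi> * cis (x * \<xi>))"
    using f1 by (rule Bochner_Integration.integrable_bound) (auto simp: norm_mult)
  have "F (x + h) - F x - h *\<^sub>R F'
      = (LINT \<xi>|lborel. f \<xi> * cis ((x + h) * \<xi>) - f \<xi> * cis (x * \<xi>) - h *\<^sub>R (\<i> * \<xi> * f \<xi> * cis (x * \<xi>)))"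
    for h unfolding F_def F'_def using integrable_mult_cis[OF f] F'_integrable by simp
  also have "\<dots> h = (LINT \<xi>|lborel. f \<xi> * cis (x * \<xi>) * r h \<xi>)" for h
    by (intro Bochner_Integration.integral_cong)
      (simp_all add: r_def cis_mult distrib_right scaleR_conv_of_real algebra_simps flip: cis_mult)
  finally have remainder: "F (x + h) - F x - h *\<^sub>R F' = (LINT \<xi>|lborel. f \<xi> * cis (x * \<xi>) * r h \<xi>)" for h .
  define Q where "Q h = (LINT \<xi>|lborel. norm (f \<xi>) * (norm (r h \<xi>) / \<bar>h\<bar>))" for h
  have "norm (F (x + h) - F x - h *\<^sub>R F') / norm h \<le> Q h" if "h \<noteq> 0" for h
  proof -
    have "norm (F (x + h) - F x - h *\<^sub>R F') \<le> (LINT \<xi>|lborel. norm (f \<xi> * cis (x * \<xi>) * r h \<xi>))"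
      unfolding remainder by (rule integral_norm_bound)
    also have "\<dots> = Q h * \<bar>h\<bar>"
      using that unfolding Q_def by (subst integral_mult_left_zero[symmetric]) (simp add: norm_mult)
    finally show ?thesis using that by (simp add: divide_simps)
  qed
  then have "eventually (\<lambda>h. norm (norm (F (x + h) - F x - h *\<^sub>R F') / norm h) \<le> Q h) (at 0)"
    by (auto simp: eventually_at_filter)
  moreover have "(Q \<longlongrightarrow> 0) (at 0)"
    unfolding Q_def r_def by (rule cis_remainder_integral_tendsto[OF _ f1]) measurable
  ultimately have "((\<lambda>h. norm (F (x + h) - F x - h *\<^sub>R F') / norm h) \<longlongrightarrow> 0) (at 0)"
    by (rule Lim_null_comparison)
  then have "(F has_vector_derivative F') (at x)"
    unfolding has_vector_derivative_def has_derivative_at using bounded_linear_scaleR_left by blast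
  then have "((\<lambda>y. F y / (2 * pi)) has_vector_derivative F' / (2 * pi)) (at x)"
    by (rule has_vector_derivative_divide)
  then show ?thesis unfolding F_def F'_def inv_fourier_def by simp
qed

lemma C_inf_inv_fourier:
  fixes h :: "real \<Rightarrow> complex"
  assumes [measurable]: "h \<in> borel_measurable lborel"
    and moments: "\<And>k. integrable lborel (\<lambda>\<xi>. \<bar>\<xi>\<bar> ^ k * norm (h \<xi>))"
  shows "C_inf (inv_fourier h)"
  unfolding C_inf_def
proof (intro exI conjI allI)
  define D where "D n = inv_fourier (\<lambda>\<xi>. (\<i> * \<xi>) ^ n * h \<xi>)" for n
  have integrable: "integrable lborel (\<lambda>\<xi>. \<xi> ^ m * ((\<i> * \<xi>) ^ n * h \<xi>))" for m n
    using moments[of "m + n"]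
    by (rule Bochner_Integration.integrable_bound) (auto simp: norm_mult norm_power power_add)
  show "(D n has_vector_derivative D (Suc n) x) (at x)" for n x
    using inv_fourier_has_vector_derivative[OF integrable[of 0 n, simplified] integrable[of 1 n, simplified]]
    by (simp add: D_def mult.assoc)
  show "D 0 = inv_fourier h" by (simp add: D_def)
qed

lemma C_inf_imp_continuous: "C_inf f \<Longrightarrow> continuous_on UNIV f"
  unfolding C_inf_def
  by (metis continuous_on_vector_derivative UNIV_I)

section \<open>Convolution\<close>

definition conv_fun :: "(real \<Rightarrow> complex) \<Rightarrow> (real \<Rightarrow> complex) \<Rightarrow> real \<Rightarrow> complex" where
  "conv_fun f g \<xi> = (LINT \<eta>|lborel. f \<eta> * g (\<xi> - \<eta>))"

lemma conv_fun_measurable [measurable]: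
  assumes [measurable]: "f \<in> borel_measurable lborel" "g \<in> borel_measurable lborel"
  shows "conv_fun f g \<in> borel_measurable borel"
  unfolding conv_fun_def[abs_def] by measurable

lemma integrable_conv_fun_kernel:
  fixes f g :: "real \<Rightarrow> complex"
  assumes f: "integrable lborel f" and g: "integrable lborel g"
  shows "integrable (lborel \<Otimes>\<^sub>M lborel) (\<lambda>(\<eta>, \<xi>). f \<eta> * g (\<xi> - \<eta>))"
proof (rule lborel_pair.Fubini_integrable)
  have [measurable]: "f \<in> borel_measurable lborel" "g \<in> borel_measurable lborel" using f g by auto
  show "(\<lambda>(\<eta>, \<xi>). f \<eta> * g (\<xi> - \<eta>)) \<in> borel_measurable (lborel \<Otimes>\<^sub>M lborel)" by measurable
  have "(LINT \<xi>|lborel. norm (f \<eta> * g (\<xi> - \<eta>))) = norm (f \<eta>) * (LINT \<xi>|lborel. norm (g \<xi>))" for \<eta>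
    by (simp add: norm_mult lborel_integral_translate[of "\<lambda>\<xi>. norm (g \<xi>)"])
  then show "integrable lborel (\<lambda>\<eta>. LINT \<xi>|lborel. norm (case (\<eta>, \<xi>) of (\<eta>, \<xi>) \<Rightarrow> f \<eta> * g (\<xi> - \<eta>)))"
    using f by simp
  show "AE \<eta> in lborel. integrable lborel (\<lambda>\<xi>. case (\<eta>, \<xi>) of (\<eta>, \<xi>) \<Rightarrow> f \<eta> * g (\<xi> - \<eta>))"
    using g by (simp add: lborel_integrable_translate_iff[of g])
qed

lemma conv_fun_zero_left: "conv_fun (\<lambda>_. 0) g = (\<lambda>_. 0)"
  by (simp add: conv_fun_def fun_eq_iff)

lemma integrable_conv_fun:
  "integrable lborel f \<Longrightarrow> integrable lborel g \<Longrightarrow> integrable lborel (conv_fun f g)"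
  using lborel_pair.integrable_snd[OF integrable_conv_fun_kernel] unfolding conv_fun_def[abs_def] by simp

lemma conv_fun_diff:
  assumes "integrable lborel (\<lambda>\<eta>. f \<eta> * g (\<xi> - \<eta>))" "integrable lborel (\<lambda>\<eta>. f' \<eta> * g' (\<xi> - \<eta>))"
    "integrable lborel (\<lambda>\<eta>. f' \<eta> * g (\<xi> - \<eta>))"
  shows "conv_fun f g \<xi> - conv_fun f' g' \<xi>
    = conv_fun (\<lambda>\<eta>. f \<eta> - f' \<eta>) g \<xi> + conv_fun f' (\<lambda>\<zeta>. g \<zeta> - g' \<zeta>) \<xi>"
  using assms unfolding conv_fun_def by (simp add: left_diff_distrib right_diff_distrib)

lemma inv_fourier_conv_fun:
  fixes f g :: "real \<Rightarrow> complex"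
  assumes f: "integrable lborel f" and g: "integrable lborel g"
  shows "inv_fourier f x * inv_fourier g x = inv_fourier (\<lambda>\<xi>. conv_fun f g \<xi> / (2 * pi)) x"
proof -
  have [measurable]: "f \<in> borel_measurable lborel" "g \<in> borel_measurable lborel" using f g by auto
  have kernel: "integrable (lborel \<Otimes>\<^sub>M lborel) (\<lambda>(\<eta>, \<xi>). f \<eta> * g (\<xi> - \<eta>) * cis (x * \<xi>))"
  proof (rule Bochner_Integration.integrable_bound[OF integrable_conv_fun_kernel[OF f g]])
    show "(\<lambda>(\<eta>, \<xi>). f \<eta> * g (\<xi> - \<eta>) * cis (x * \<xi>)) \<in> borel_measurable (lborel \<Otimes>\<^sub>M lborel)"
      by measurable
  qed (intro AE_I2, simp add: norm_mult split: prod.splits)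
  have inner: "f \<eta> * cis (x * \<eta>) * (LINT \<zeta>|lborel. g \<zeta> * cis (x * \<zeta>))
      = (LINT \<xi>|lborel. f \<eta> * g (\<xi> - \<eta>) * cis (x * \<xi>))" for \<eta>
  proof -
    have "(LINT \<zeta>|lborel. g \<zeta> * cis (x * \<zeta>)) = (LINT \<xi>|lborel. g (\<xi> - \<eta>) * cis (x * (\<xi> - \<eta>)))"
      using lborel_integral_translate[of "\<lambda>\<zeta>. g \<zeta> * cis (x * \<zeta>)" \<eta>] by simp
    moreover have "cis (x * \<eta>) * cis (x * (\<xi> - \<eta>)) = cis (x * \<xi>)" for \<xi>
      by (simp add: cis_mult algebra_simps)
    ultimately show ?thesis
      by (simp add: mult.assoc mult.left_commute flip: integral_mult_right_zero)
  qed
  have "(LINT \<eta>|lborel. f \<eta> * cis (x * \<eta>)) * (LINT \<zeta>|lborel. g \<zeta> * cis (x * \<zeta>))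
      = (LINT \<eta>|lborel. LINT \<xi>|lborel. f \<eta> * g (\<xi> - \<eta>) * cis (x * \<xi>))"
    by (simp add: inner flip: integral_mult_left_zero)
  also have "\<dots> = (LINT \<xi>|lborel. LINT \<eta>|lborel. f \<eta> * g (\<xi> - \<eta>) * cis (x * \<xi>))"
    using lborel_pair.Fubini_integral[of "\<lambda>\<eta> \<xi>. f \<eta> * g (\<xi> - \<eta>) * cis (x * \<xi>)"] kernel by simp
  also have "\<dots> = (LINT \<xi>|lborel. conv_fun f g \<xi> * cis (x * \<xi>))"
    unfolding conv_fun_def by (simp add: integral_mult_left_zero)
  finally have "(LINT \<eta>|lborel. f \<eta> * cis (x * \<eta>)) * (LINT \<zeta>|lborel. g \<zeta> * cis (x * \<zeta>))
      = (LINT \<xi>|lborel. conv_fun f g \<xi> * cis (x * \<xi>))" .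
  moreover have "(LINT \<xi>|lborel. conv_fun f g \<xi> / (2 * pi) * cis (x * \<xi>))
      = (LINT \<xi>|lborel. conv_fun f g \<xi> * cis (x * \<xi>)) / (2 * pi)"
    by (simp flip: integral_divide_zero)
  ultimately show ?thesis unfolding inv_fourier_def by simp
qed

section \<open>Square integrability of inverse Fourier transforms\<close>

lemma norm_conv_fun_le:
  fixes f g :: "real \<Rightarrow> complex"
  assumes [measurable]: "f \<in> borel_measurable lborel" "g \<in> borel_measurable lborel"
    and f2: "integrable lborel (\<lambda>\<eta>. (norm (f \<eta>))\<^sup>2)" and g2: "integrable lborel (\<lambda>\<eta>. (norm (g \<eta>))\<^sup>2)"
  shows "norm (conv_fun f g \<xi>) \<le> ((LINT \<eta>|lborel. (norm (f \<eta>))\<^sup>2) + (LINT \<eta>|lborel. (norm (g \<eta>))\<^sup>2)) / 2"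
proof -
  define B where "B \<eta> = ((norm (f \<eta>))\<^sup>2 + (norm (g (\<xi> - \<eta>)))\<^sup>2) / 2" for \<eta>
  have B: "integrable lborel B"
    unfolding B_def using f2 g2 by (simp add: lborel_integrable_reflect_iff[of "\<lambda>\<eta>. (norm (g \<eta>))\<^sup>2"])
  have am_gm: "norm (f \<eta> * g (\<xi> - \<eta>)) \<le> B \<eta>" for \<eta>
    using sum_squares_bound[of "norm (f \<eta>)" "norm (g (\<xi> - \<eta>))"] by (simp add: B_def norm_mult)
  have fg: "integrable lborel (\<lambda>\<eta>. f \<eta> * g (\<xi> - \<eta>))"
    using B by (rule Bochner_Integration.integrable_bound) (auto intro: order_trans[OF am_gm abs_ge_self])
  have "norm (conv_fun f g \<xi>) \<le> (LINT \<eta>|lborel. norm (f \<eta> * g (\<xi> - \<eta>)))"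
    unfolding conv_fun_def by (rule integral_norm_bound)
  also have "\<dots> \<le> (LINT \<eta>|lborel. B \<eta>)"
    using fg B am_gm by (intro integral_mono) auto
  also have "\<dots> = ((LINT \<eta>|lborel. (norm (f \<eta>))\<^sup>2) + (LINT \<eta>|lborel. (norm (g \<eta>))\<^sup>2)) / 2"
    unfolding B_def using f2 g2
    by (simp add: lborel_integrable_reflect_iff[of "\<lambda>\<eta>. (norm (g \<eta>))\<^sup>2"]
        lborel_integral_reflect[of "\<lambda>\<eta>. (norm (g \<eta>))\<^sup>2"])
  finally show ?thesis .
qed

lemma norm_inv_fourier_square:
  fixes h :: "real \<Rightarrow> complex"
  assumes h: "integrable lborel h"
  shows "complex_of_real ((norm (inv_fourier h x))\<^sup>2)
    = inv_fourier (\<lambda>\<xi>. conv_fun h (\<lambda>\<eta>. cnj (h (- \<eta>))) \<xi> / (2 * pi)) x"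
proof -
  have "integrable lborel (\<lambda>\<eta>. cnj (h (0 - \<eta>)))"
    using h by (simp only: lborel_integrable_reflect_iff complex_integrable_cnj)
  then show ?thesis
    unfolding complex_norm_square cnj_inv_fourier using inv_fourier_conv_fun[OF h] by simp
qed

lemma norm_integral_inv_fourier_gaussian_le:
  fixes k :: "real \<Rightarrow> complex"
  assumes k: "integrable lborel k" and bound: "\<And>y. norm (k y) \<le> C" and e: "e > 0"
  shows "norm (LINT x|lborel. inv_fourier k x * exp (- e * x\<^sup>2)) \<le> C"
proof -
  have [measurable]: "k \<in> borel_measurable lborel" using k by auto
  have "(LINT x|lborel. inv_fourier k x * exp (- e * x\<^sup>2))
      = (LINT x|lborel. fourier k (0 - x) * exp (- e * (0 - x)\<^sup>2)) / (2 * pi)"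
    by (simp add: inv_fourier_eq_fourier flip: integral_divide_zero)
  also have "\<dots> = (LINT x|lborel. fourier k x * cis (0 * x) * exp (- e * x\<^sup>2)) / (2 * pi)"
    using lborel_integral_reflect[of "\<lambda>x. fourier k x * complex_of_real (exp (- e * x\<^sup>2))" 0] by simp
  also have "\<dots> = (LINT y|lborel. k y * gauss_kernel e (0 - y)) / (2 * pi)"
    by (simp only: integral_fourier_cis_gaussian[OF k e])
  finally have eq: "(LINT x|lborel. inv_fourier k x * exp (- e * x\<^sup>2))
      = (LINT y|lborel. k y * gauss_kernel e (0 - y)) / (2 * pi)" .
  have G: "integrable lborel (\<lambda>y. C * gauss_kernel e (0 - y))"
    using integrable_gauss_kernel[OF e, of 0] by simp
  have pointwise: "norm (k y * gauss_kernel e (0 - y)) \<le> C * gauss_kernel e (0 - y)" for y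
    using bound[of y] gauss_kernel_nonneg[OF e, of "0 - y"] by (simp add: norm_mult mult_right_mono)
  have kG: "integrable lborel (\<lambda>y. k y * complex_of_real (gauss_kernel e (0 - y)))"
  proof (rule Bochner_Integration.integrable_bound[OF G])
    show "AE y in lborel. norm (k y * complex_of_real (gauss_kernel e (0 - y))) \<le> norm (C * gauss_kernel e (0 - y))"
      by (intro AE_I2) (simp only: real_norm_def, rule order_trans[OF pointwise abs_ge_self])
  qed measurable
  have "norm (LINT y|lborel. k y * gauss_kernel e (0 - y)) \<le> (LINT y|lborel. norm (k y * gauss_kernel e (0 - y)))"
    by (rule integral_norm_bound)
  also have "\<dots> \<le> (LINT y|lborel. C * gauss_kernel e (0 - y))"
    using kG G pointwise by (intro integral_mono) auto
  also have "\<dots> = C * (2 * pi)" using integral_gauss_kernel[OF e, of 0] by simp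
  finally show ?thesis unfolding eq by (simp add: norm_divide divide_le_eq)
qed

lemma integrable_of_gaussian_weighted_bounded:
  fixes f :: "real \<Rightarrow> real"
  assumes [measurable]: "f \<in> borel_measurable lborel"
    and nonneg: "\<And>x. 0 \<le> f x" and bounded: "\<And>x. f x \<le> M"
    and weighted: "\<And>e. e > 0 \<Longrightarrow> (LINT x|lborel. f x * exp (- e * x\<^sup>2)) \<le> C"
  shows "integrable lborel f"
proof -
  define g where "g n x = f x * exp (- (1 / real (Suc n)) * x\<^sup>2)" for n x
  have "0 \<le> M" using nonneg[of 0] bounded[of 0] by linarith
  have g: "integrable lborel (g n)" for n
  proof -
    have "integrable lborel (\<lambda>x. M * exp (- (1 / real (Suc n)) * x\<^sup>2))"
      using integrable_gaussian[of "1 / real (Suc n)"] by simp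
    then show ?thesis unfolding g_def
      by (rule Bochner_Integration.integrable_bound)
        (use nonneg bounded \<open>0 \<le> M\<close> in \<open>auto intro!: mult_right_mono\<close>)
  qed
  have g_mono: "g n x \<le> g (Suc n) x" for n x
    unfolding g_def using nonneg[of x]
    by (intro mult_left_mono) (simp_all add: frac_le mult_right_mono)
  show ?thesis
  proof (rule integral_monotone_convergence_nonneg)
    show "AE x in lborel. mono (\<lambda>n. g n x)"
      using g_mono by (intro AE_I2 monoI, rule lift_Suc_mono_le[of "\<lambda>n. g n _"]) auto
    show "AE x in lborel. (\<lambda>n. g n x) \<longlonglongrightarrow> f x"
    proof (intro AE_I2)
      fix x
      have "(\<lambda>n. g n x) \<longlonglongrightarrow> f x * exp (- 0 * x\<^sup>2)"
        unfolding g_def by (intro tendsto_intros LIMSEQ_inverse_real_of_nat[unfolded inverse_eq_divide])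
      then show "(\<lambda>n. g n x) \<longlonglongrightarrow> f x" by simp
    qed
    have "incseq (\<lambda>n. integral\<^sup>L lborel (g n))"
      using g g_mono by (intro incseq_SucI integral_mono) auto
    moreover have "integral\<^sup>L lborel (g n) \<le> C" for n
      unfolding g_def using weighted[of "1 / real (Suc n)"] by simp
    then have "bdd_above (range (\<lambda>n. integral\<^sup>L lborel (g n)))"
      by (intro bdd_aboveI[where M = C]) auto
    ultimately show "(\<lambda>n. integral\<^sup>L lborel (g n)) \<longlonglongrightarrow> (SUP n. integral\<^sup>L lborel (g n))"
      by (intro LIMSEQ_incseq_SUP)
    show "integrable lborel (g n)" for n by (rule g)
    show "AE x in lborel. 0 \<le> g n x" for n using nonneg by (simp add: g_def)
  qed measurable
qed

lemma integrable_norm_square_if_bounded: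
  fixes h :: "real \<Rightarrow> complex"
  assumes h: "integrable lborel h" and bounded: "\<And>\<xi>. norm (h \<xi>) \<le> B"
  shows "integrable lborel (\<lambda>\<xi>. (norm (h \<xi>))\<^sup>2)"
proof (rule Bochner_Integration.integrable_bound)
  have "0 \<le> B" using bounded[of 0] norm_ge_zero order_trans by blast
  show "integrable lborel (\<lambda>\<xi>. B * norm (h \<xi>))" using h by simp
  show "AE \<xi> in lborel. norm ((norm (h \<xi>))\<^sup>2) \<le> norm (B * norm (h \<xi>))"
    using bounded \<open>0 \<le> B\<close> by (intro AE_I2) (simp add: power2_eq_square abs_mult mult_right_mono)
qed (use h in measurable)

lemma integral_norm_inv_fourier_square_gaussian_le:
  fixes h :: "real \<Rightarrow> complex"
  assumes h: "integrable lborel h" and h2: "integrable lborel (\<lambda>\<xi>. (norm (h \<xi>))\<^sup>2)" and e: "e > 0"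
  shows "(LINT x|lborel. (norm (inv_fourier h x))\<^sup>2 * exp (- e * x\<^sup>2))
    \<le> (LINT \<xi>|lborel. (norm (h \<xi>))\<^sup>2) / (2 * pi)"
proof -
  have [measurable]: "h \<in> borel_measurable lborel" using h by auto
  define h' where "h' = (\<lambda>\<eta>. cnj (h (- \<eta>)))"
  define C where "C = (LINT \<xi>|lborel. (norm (h \<xi>))\<^sup>2) / (2 * pi)"
  have h'2: "integrable lborel (\<lambda>\<xi>. (norm (h' \<xi>))\<^sup>2)" and "(LINT \<xi>|lborel. (norm (h' \<xi>))\<^sup>2) = 2 * pi * C"
    using h2 lborel_integrable_reflect_iff[of "\<lambda>\<xi>. (norm (h \<xi>))\<^sup>2" 0]
      lborel_integral_reflect[of "\<lambda>\<xi>. (norm (h \<xi>))\<^sup>2" 0]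
    by (simp_all add: h'_def C_def)
  then have k_bound: "norm (conv_fun h h' y / (2 * pi)) \<le> C" for y
    using norm_conv_fun_le[OF _ _ h2 h'2, of y] by (simp add: h'_def C_def norm_divide divide_simps)
  have k: "integrable lborel (\<lambda>\<xi>. conv_fun h h' \<xi> / (2 * pi))"
    using integrable_conv_fun[OF h, of h'] h
    by (simp add: h'_def lborel_integrable_reflect_iff[of "\<lambda>\<eta>. cnj (h \<eta>)" 0, simplified])
  have "(LINT x|lborel. (norm (inv_fourier h x))\<^sup>2 * exp (- e * x\<^sup>2))
      \<le> norm (complex_of_real (LINT x|lborel. (norm (inv_fourier h x))\<^sup>2 * exp (- e * x\<^sup>2)))"
    by simp
  also have "complex_of_real (LINT x|lborel. (norm (inv_fourier h x))\<^sup>2 * exp (- e * x\<^sup>2))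
      = (LINT x|lborel. complex_of_real ((norm (inv_fourier h x))\<^sup>2 * exp (- e * x\<^sup>2)))"
    by (rule integral_complex_of_real[symmetric])
  also have "\<dots> = (LINT x|lborel. inv_fourier (\<lambda>\<xi>. conv_fun h h' \<xi> / (2 * pi)) x * exp (- e * x\<^sup>2))"
    by (intro Bochner_Integration.integral_cong refl)
      (simp only: of_real_mult norm_inv_fourier_square[OF h] h'_def)
  also have "norm \<dots> \<le> C"
    by (rule norm_integral_inv_fourier_gaussian_le[OF k k_bound e])
  finally show ?thesis unfolding C_def .
qed

lemma L2_inv_fourier:
  fixes h :: "real \<Rightarrow> complex"
  assumes h: "integrable lborel h" and bounded: "\<And>\<xi>. norm (h \<xi>) \<le> B"
  shows "L2 (inv_fourier h)"
  unfolding L2_def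
proof (intro conjI integrable_of_gaussian_weighted_bounded)
  have [measurable]: "h \<in> borel_measurable lborel" using h by auto
  show "(\<lambda>x. (norm (inv_fourier h x))\<^sup>2) \<in> borel_measurable lborel" by measurable
  show "(norm (inv_fourier h x))\<^sup>2 \<le> ((LINT \<xi>|lborel. norm (h \<xi>)) / (2 * pi))\<^sup>2" for x
    using norm_inv_fourier_le[OF h, of x] by (simp add: power_mono)
  show "(LINT x|lborel. (norm (inv_fourier h x))\<^sup>2 * exp (- e * x\<^sup>2))
      \<le> (LINT \<xi>|lborel. (norm (h \<xi>))\<^sup>2) / (2 * pi)" if "e > 0" for e
    by (rule integral_norm_inv_fourier_square_gaussian_le[OF h integrable_norm_square_if_bounded[OF h bounded] that])
  show "0 \<le> (norm (inv_fourier h x))\<^sup>2" for x by simp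
  show "inv_fourier h \<in> borel_measurable lborel" by measurable
qed

section \<open>Exponentially weighted bounds and convolution powers\<close>

definition exp_weight :: "real \<Rightarrow> real \<Rightarrow> real" where
  "exp_weight c \<xi> = exp (- c * \<bar>\<xi>\<bar>)"

lemma exp_weight_pos: "exp_weight c \<xi> > 0"
  by (simp add: exp_weight_def)

lemma exp_weight_le_one: "c \<ge> 0 \<Longrightarrow> exp_weight c \<xi> \<le> 1"
  by (simp add: exp_weight_def)

lemma exp_weight_antimono: "c \<le> c' \<Longrightarrow> exp_weight c' \<xi> \<le> exp_weight c \<xi>"
  by (simp add: exp_weight_def mult_right_mono)

lemma exp_weight_mult_le:
  assumes "c \<ge> 0"
  shows "exp_weight c \<eta> * exp_weight c (\<xi> - \<eta>) \<le> exp_weight c \<xi>"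
proof -
  have "c * \<bar>\<xi>\<bar> \<le> c * (\<bar>\<eta>\<bar> + \<bar>\<xi> - \<eta>\<bar>)"
    using assms by (intro mult_left_mono) linarith+
  then show ?thesis unfolding exp_weight_def by (simp add: algebra_simps flip: exp_add)
qed

lemma exp_weight_measurable [measurable (raw)]:
  "f \<in> borel_measurable M \<Longrightarrow> (\<lambda>x. exp_weight c (f x)) \<in> borel_measurable M"
  unfolding exp_weight_def by measurable

lemma integrable_exp_weight: "c > 0 \<Longrightarrow> integrable lborel (exp_weight c)"
  using integrable_exp_neg_abs unfolding exp_weight_def[abs_def] by blast

lemma integrable_exp_weight_bounded:
  fixes f :: "real \<Rightarrow> complex"
  assumes "c > 0" "f \<in> borel_measurable lborel" "\<And>\<xi>. norm (f \<xi>) \<le> K * exp_weight c \<xi>"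
  shows "integrable lborel f"
proof (rule Bochner_Integration.integrable_bound)
  show "integrable lborel (\<lambda>\<xi>. K * exp_weight c \<xi>)" using integrable_exp_weight[OF assms(1)] by simp
  show "AE \<xi> in lborel. norm (f \<xi>) \<le> norm (K * exp_weight c \<xi>)"
    using assms(3) by (intro AE_I2) (simp only: real_norm_def, rule order_trans[OF _ abs_ge_self])
qed (rule assms(2))

text \<open>Used for Fourier transforms: support in \<open>[-R, R]\<close> means that the inverse transform is
  band-limited.\<close>

definition band_limited :: "real \<Rightarrow> real \<Rightarrow> real \<Rightarrow> (real \<Rightarrow> complex) \<Rightarrow> bool" where
  "band_limited R c B f \<longleftrightarrow> f \<in> borel_measurable lborel \<and> (\<forall>\<eta>. R < \<bar>\<eta>\<bar> \<longrightarrow> f \<eta> = 0)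
    \<and> (\<forall>\<eta>. norm (f \<eta>) \<le> B * exp_weight c \<eta>)"

lemma weight_bound_nonneg: "(\<And>\<xi>. norm (f \<xi>) \<le> B * exp_weight c \<xi>) \<Longrightarrow> 0 \<le> B"
  using norm_ge_zero order_trans by (metis exp_weight_def abs_zero exp_zero mult_zero_right mult_1_right)

lemma band_limited_bound: "band_limited R c B f \<Longrightarrow> norm (f \<xi>) \<le> B * exp_weight c \<xi>"
  by (simp add: band_limited_def)

lemma band_limited_nonneg: "band_limited R c B f \<Longrightarrow> 0 \<le> B"
  unfolding band_limited_def using weight_bound_nonneg[of f B c] by blast

lemma conv_fun_band_limited_bound:
  fixes f g :: "real \<Rightarrow> complex"
  assumes f: "band_limited R c A f" and [measurable]: "g \<in> borel_measurable lborel"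
    and g: "\<And>\<xi>. norm (g \<xi>) \<le> B * exp_weight c \<xi>" and c: "0 \<le> c" and R: "0 \<le> R"
  shows "integrable lborel (\<lambda>\<eta>. f \<eta> * g (\<xi> - \<eta>))"
    and "norm (conv_fun f g \<xi>) \<le> 2 * R * A * B * exp_weight c \<xi>"
proof -
  have [measurable]: "f \<in> borel_measurable lborel" using f by (simp add: band_limited_def)
  have "0 \<le> A" "0 \<le> B"
    using band_limited_nonneg[OF f] weight_bound_nonneg[of g B c, OF g] by simp_all
  define K where "K = (\<lambda>\<eta>::real. A * B * exp_weight c \<xi> * indicator {-R..R} \<eta>)"
  have K: "integrable lborel K" and K_integral: "(LINT \<eta>|lborel. K \<eta>) = 2 * R * A * B * exp_weight c \<xi>"
    using R by (simp_all add: K_def measure_lborel_Icc emeasure_lborel_Icc_eq integrable_real_indicator)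
  have pointwise: "norm (f \<eta> * g (\<xi> - \<eta>)) \<le> K \<eta>" for \<eta>
  proof (cases "\<bar>\<eta>\<bar> \<le> R")
    case True
    have "norm (f \<eta> * g (\<xi> - \<eta>)) \<le> (A * exp_weight c \<eta>) * (B * exp_weight c (\<xi> - \<eta>))"
      unfolding norm_mult using f g \<open>0 \<le> A\<close>
      by (intro mult_mono) (auto simp: band_limited_def less_imp_le[OF exp_weight_pos])
    also have "\<dots> \<le> A * B * exp_weight c \<xi>"
      using exp_weight_mult_le[OF c, of \<eta> \<xi>] \<open>0 \<le> A\<close> \<open>0 \<le> B\<close>
      by (simp add: mult_left_mono mult_ac)
    finally show ?thesis using True by (simp add: K_def abs_le_iff)
  next
    case False
    then have "f \<eta> = 0" using f by (simp add: band_limited_def)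
    then show ?thesis using False by (auto simp: K_def indicator_def)
  qed
  show fg: "integrable lborel (\<lambda>\<eta>. f \<eta> * g (\<xi> - \<eta>))"
  proof (rule Bochner_Integration.integrable_bound[OF K])
    show "AE \<eta> in lborel. norm (f \<eta> * g (\<xi> - \<eta>)) \<le> norm (K \<eta>)"
      by (intro AE_I2) (simp only: real_norm_def, rule order_trans[OF pointwise abs_ge_self])
  qed measurable
  have "norm (conv_fun f g \<xi>) \<le> (LINT \<eta>|lborel. norm (f \<eta> * g (\<xi> - \<eta>)))"
    unfolding conv_fun_def by (rule integral_norm_bound)
  also have "\<dots> \<le> (LINT \<eta>|lborel. K \<eta>)"
    using fg K pointwise by (intro integral_mono) auto
  finally show "norm (conv_fun f g \<xi>) \<le> 2 * R * A * B * exp_weight c \<xi>" unfolding K_integral .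
qed

text \<open>Index shift: \<^term>\<open>conv_power f n\<close> is the \<open>(n + 1)\<close>-fold convolution power.\<close>

primrec conv_power :: "(real \<Rightarrow> complex) \<Rightarrow> nat \<Rightarrow> real \<Rightarrow> complex" where
  "conv_power f 0 = f"
| "conv_power f (Suc n) = (\<lambda>\<xi>. conv_fun f (conv_power f n) \<xi> / (2 * pi))"

lemma conv_power_measurable [measurable]:
  "f \<in> borel_measurable lborel \<Longrightarrow> conv_power f n \<in> borel_measurable lborel"
  by (induction n) simp_all

lemma conv_power_zero: "conv_power (\<lambda>_. 0) n = (\<lambda>_. 0)"
  by (induction n) (simp_all add: conv_fun_zero_left)

lemma integrable_conv_power: "integrable lborel f \<Longrightarrow> integrable lborel (conv_power f n)"
  by (induction n) (simp_all add: integrable_conv_fun)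

lemma inv_fourier_conv_power:
  assumes f: "integrable lborel f"
  shows "inv_fourier (conv_power f n) x = (inv_fourier f x) ^ Suc n"
proof (induction n)
  case (Suc n)
  show ?case
    by (simp only: conv_power.simps inv_fourier_conv_fun[OF f integrable_conv_power[OF f], symmetric]
        Suc.IH power_Suc)
qed simp

lemma norm_conv_power_le:
  assumes f: "band_limited R c B f" and c: "0 \<le> c" and R: "0 \<le> R"
  shows "norm (conv_power f n \<xi>) \<le> B * (R * B / pi) ^ n * exp_weight c \<xi>"
proof (induction n arbitrary: \<xi>)
  case 0
  then show ?case using f by (simp add: band_limited_def)
next
  case (Suc n)
  have [measurable]: "f \<in> borel_measurable lborel" using f by (simp add: band_limited_def)
  have "norm (conv_power f (Suc n) \<xi>) = norm (conv_fun f (conv_power f n) \<xi>) / (2 * pi)"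
    by (simp add: norm_divide norm_mult)
  also have "\<dots> \<le> 2 * R * B * (B * (R * B / pi) ^ n) * exp_weight c \<xi> / (2 * pi)"
    by (intro divide_right_mono conv_fun_band_limited_bound(2)[OF f _ Suc.IH c R]) simp_all
  also have "\<dots> = B * (R * B / pi) ^ Suc n * exp_weight c \<xi>"
    by (simp add: power_Suc field_simps)
  finally show ?case .
qed

lemma conv_power_lipschitz:
  assumes f: "band_limited R c B f" and f': "band_limited R c B f'"
    and diff: "band_limited R c d (\<lambda>\<eta>. f \<eta> - f' \<eta>)" and c: "0 \<le> c" and R: "0 \<le> R"
  shows "norm (conv_power f n \<xi> - conv_power f' n \<xi>)
    \<le> (real n + 1) * d * (R * B / pi) ^ n * exp_weight c \<xi>"
proof (induction n arbitrary: \<xi>)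
  case 0
  then show ?case using diff by (simp add: band_limited_def)
next
  case (Suc n)
  have [measurable]: "f \<in> borel_measurable lborel" "f' \<in> borel_measurable lborel"
    using f f' by (simp_all add: band_limited_def)
  note bound = norm_conv_power_le[OF f c R, of n] and bound' = norm_conv_power_le[OF f' c R, of n]
  have "conv_fun f (conv_power f n) \<xi> - conv_fun f' (conv_power f' n) \<xi>
      = conv_fun (\<lambda>\<eta>. f \<eta> - f' \<eta>) (conv_power f n) \<xi>
        + conv_fun f' (\<lambda>\<zeta>. conv_power f n \<zeta> - conv_power f' n \<zeta>) \<xi>"
  proof (rule conv_fun_diff)
    show "integrable lborel (\<lambda>\<eta>. f \<eta> * conv_power f n (\<xi> - \<eta>))"
      by (rule conv_fun_band_limited_bound(1)[OF f _ bound c R]) simp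
    show "integrable lborel (\<lambda>\<eta>. f' \<eta> * conv_power f' n (\<xi> - \<eta>))"
      by (rule conv_fun_band_limited_bound(1)[OF f' _ bound' c R]) simp
    show "integrable lborel (\<lambda>\<eta>. f' \<eta> * conv_power f n (\<xi> - \<eta>))"
      by (rule conv_fun_band_limited_bound(1)[OF f' _ bound c R]) simp
  qed
  also have "norm \<dots> \<le> 2 * R * d * (B * (R * B / pi) ^ n) * exp_weight c \<xi>
      + 2 * R * B * ((real n + 1) * d * (R * B / pi) ^ n) * exp_weight c \<xi>"
  proof (rule order.trans[OF norm_triangle_ineq add_mono])
    show "norm (conv_fun (\<lambda>\<eta>. f \<eta> - f' \<eta>) (conv_power f n) \<xi>)
        \<le> 2 * R * d * (B * (R * B / pi) ^ n) * exp_weight c \<xi>"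
      by (rule conv_fun_band_limited_bound(2)[OF diff _ bound c R]) measurable
    show "norm (conv_fun f' (\<lambda>\<zeta>. conv_power f n \<zeta> - conv_power f' n \<zeta>) \<xi>)
        \<le> 2 * R * B * ((real n + 1) * d * (R * B / pi) ^ n) * exp_weight c \<xi>"
      by (rule conv_fun_band_limited_bound(2)[OF f' _ Suc.IH c R]) measurable
  qed
  finally have "norm (conv_power f (Suc n) \<xi> - conv_power f' (Suc n) \<xi>)
      \<le> (2 * R * d * (B * (R * B / pi) ^ n) * exp_weight c \<xi>
        + 2 * R * B * ((real n + 1) * d * (R * B / pi) ^ n) * exp_weight c \<xi>) / (2 * pi)"
    by (simp add: diff_divide_distrib[symmetric] norm_divide norm_mult divide_right_mono)
  also have "\<dots> = (real (Suc n) + 1) * d * (R * B / pi) ^ Suc n * exp_weight c \<xi>"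
    by (simp add: power_Suc field_simps)
  finally show ?case .
qed

lemma norm_conv_power_fact_le:
  assumes "band_limited R c B f" "0 \<le> c" "0 \<le> R"
  shows "norm (conv_power f (Suc n) \<xi> / fact (n + 2)) \<le> B * exp_weight c \<xi> * (R * B / pi) ^ Suc n"
proof -
  have "norm (z / fact k) \<le> norm z" for z :: complex and k
    by (simp add: norm_divide divide_le_eq mult_le_cancel_left1)
  also have "norm (conv_power f (Suc n) \<xi>) \<le> B * exp_weight c \<xi> * (R * B / pi) ^ Suc n"
    using norm_conv_power_le[OF assms, of "Suc n" \<xi>] by (simp only: mult_ac)
  finally show ?thesis .
qed

lemma exp_minus_one_minus_sums: "(\<lambda>n. z ^ (n + 2) / fact (n + 2)) sums (exp z - 1 - z)"
  for z :: complex
proof -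
  have "(\<lambda>n. z ^ (n + 2) /\<^sub>R fact (n + 2)) sums (exp z - (\<Sum>n<2. z ^ n /\<^sub>R fact n))"
    using exp_converges[of z] by (subst sums_iff_shift) simp
  then show ?thesis
    by (simp add: numeral_2_eq_2 scaleR_conv_of_real divide_inverse mult.commute diff_diff_eq)
qed

lemma sums_geometric_Suc:
  fixes q K :: real
  shows "0 \<le> q \<Longrightarrow> q < 1 \<Longrightarrow> (\<lambda>n. K * q ^ Suc n) sums (K * q / (1 - q))"
  using sums_mult[OF geometric_sums[of q], of "K * q"] by (simp add: field_simps)

definition conv_exp_remainder :: "(real \<Rightarrow> complex) \<Rightarrow> real \<Rightarrow> complex" where
  "conv_exp_remainder f \<xi> = (\<Sum>n. conv_power f (Suc n) \<xi> / fact (n + 2))"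

lemma conv_exp_remainder_zero: "conv_exp_remainder (\<lambda>_. 0) = (\<lambda>_. 0)"
  by (simp add: conv_exp_remainder_def conv_power_zero fun_eq_iff)

context
  fixes R c B :: real and f :: "real \<Rightarrow> complex"
  assumes f: "band_limited R c B f" and c: "0 \<le> c" and R: "0 \<le> R" and ratio: "R * B / pi < 1"
begin

private lemma growth_nonneg: "0 \<le> R * B / pi"
  using band_limited_nonneg[OF f] R by simp

private lemmas geometric = sums_geometric_Suc[OF growth_nonneg ratio]

lemma summable_conv_exp_remainder: "summable (\<lambda>n. conv_power f (Suc n) \<xi> / fact (n + 2))"
  by (rule summable_comparison_test'[OF sums_summable[OF geometric]])
    (rule norm_conv_power_fact_le[OF f c R])

lemma norm_conv_exp_remainder_le:
  "norm (conv_exp_remainder f \<xi>) \<le> B * exp_weight c \<xi> * (R * B / pi) / (1 - R * B / pi)"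
proof -
  have "norm (conv_exp_remainder f \<xi>) \<le> (\<Sum>n. B * exp_weight c \<xi> * (R * B / pi) ^ Suc n)"
    unfolding conv_exp_remainder_def
    by (rule norm_suminf_le[OF norm_conv_power_fact_le[OF f c R] sums_summable[OF geometric]])
  also have "\<dots> = B * exp_weight c \<xi> * (R * B / pi) / (1 - R * B / pi)"
    by (rule sums_unique[OF geometric, symmetric])
  finally show ?thesis .
qed

lemma conv_exp_remainder_measurable [measurable]: "conv_exp_remainder f \<in> borel_measurable lborel"
proof (rule borel_measurable_LIMSEQ_metric)
  have [measurable]: "f \<in> borel_measurable lborel" using f by (simp add: band_limited_def)
  show "(\<lambda>\<xi>. \<Sum>n<i. conv_power f (Suc n) \<xi> / fact (n + 2)) \<in> borel_measurable lborel" for i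
    by measurable
  show "(\<lambda>i. \<Sum>n<i. conv_power f (Suc n) \<xi> / fact (n + 2)) \<longlonglongrightarrow> conv_exp_remainder f \<xi>" for \<xi>
    unfolding conv_exp_remainder_def by (rule summable_LIMSEQ[OF summable_conv_exp_remainder])
qed

lemma integrable_conv_exp_remainder:
  assumes "0 < c"
  shows "integrable lborel (conv_exp_remainder f)"
proof (rule Bochner_Integration.integrable_bound)
  show "integrable lborel (\<lambda>\<xi>. B * exp_weight c \<xi> * (R * B / pi) / (1 - R * B / pi))"
    using integrable_exp_weight[OF assms] by simp
  show "AE \<xi> in lborel. norm (conv_exp_remainder f \<xi>)
      \<le> norm (B * exp_weight c \<xi> * (R * B / pi) / (1 - R * B / pi))"
    by (intro AE_I2) (simp only: real_norm_def, rule order_trans[OF norm_conv_exp_remainder_le abs_ge_self])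
qed (rule conv_exp_remainder_measurable)

lemma conv_exp_remainder_lipschitz:
  assumes f': "band_limited R c B f'" and diff: "band_limited R c d (\<lambda>\<eta>. f \<eta> - f' \<eta>)"
  shows "norm (conv_exp_remainder f \<xi> - conv_exp_remainder f' \<xi>)
    \<le> d * exp_weight c \<xi> * (R * B / pi) / (1 - R * B / pi)"
proof -
  have "0 \<le> d" by (rule band_limited_nonneg[OF diff])
  have term_le: "norm (conv_power f (Suc n) \<xi> / fact (n + 2) - conv_power f' (Suc n) \<xi> / fact (n + 2))
      \<le> d * exp_weight c \<xi> * (R * B / pi) ^ Suc n" for n
  proof -
    have "real (n + 2) \<le> fact (n + 2)" by (metis fact_ge_self of_nat_fact of_nat_le_iff)
    then have le_one: "(real (Suc n) + 1) / fact (n + 2) \<le> 1" by simp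
    have nonneg: "0 \<le> d * exp_weight c \<xi> * (R * B / pi) ^ Suc n"
      using \<open>0 \<le> d\<close> growth_nonneg exp_weight_pos[of c \<xi>]
      by (intro mult_nonneg_nonneg zero_le_power) simp_all
    have "norm (z / fact k - z' / fact k) = norm (z - z') / fact k" for z z' :: complex and k
      by (simp add: diff_divide_distrib[symmetric] norm_divide)
    then have "norm (conv_power f (Suc n) \<xi> / fact (n + 2) - conv_power f' (Suc n) \<xi> / fact (n + 2))
        = norm (conv_power f (Suc n) \<xi> - conv_power f' (Suc n) \<xi>) / fact (n + 2)" .
    also have "\<dots> \<le> (real (Suc n) + 1) * (d * exp_weight c \<xi> * (R * B / pi) ^ Suc n) / fact (n + 2)"
      by (rule divide_right_mono)
        (use conv_power_lipschitz[OF f f' diff c R, of "Suc n" \<xi>] in \<open>simp_all only: mult_ac fact_ge_zero\<close>)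
    also have "\<dots> = (real (Suc n) + 1) / fact (n + 2) * (d * exp_weight c \<xi> * (R * B / pi) ^ Suc n)"
      by (simp only: times_divide_eq_left)
    also have "\<dots> \<le> d * exp_weight c \<xi> * (R * B / pi) ^ Suc n"
      by (rule mult_left_le_one_le[OF nonneg _ le_one]) simp
    finally show ?thesis .
  qed
  have "summable (\<lambda>n. conv_power f' (Suc n) \<xi> / fact (n + 2))"
    by (rule summable_comparison_test'[OF sums_summable[OF geometric]])
      (rule norm_conv_power_fact_le[OF f' c R])
  then have "conv_exp_remainder f \<xi> - conv_exp_remainder f' \<xi>
      = (\<Sum>n. conv_power f (Suc n) \<xi> / fact (n + 2) - conv_power f' (Suc n) \<xi> / fact (n + 2))"
    unfolding conv_exp_remainder_def by (rule suminf_diff[OF summable_conv_exp_remainder])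
  also have "norm \<dots> \<le> (\<Sum>n. d * exp_weight c \<xi> * (R * B / pi) ^ Suc n)"
    by (rule norm_suminf_le[OF term_le sums_summable[OF geometric]])
  also have "\<dots> = d * exp_weight c \<xi> * (R * B / pi) / (1 - R * B / pi)"
    by (rule sums_unique[OF geometric, symmetric])
  finally show ?thesis .
qed

lemma inv_fourier_conv_exp_remainder:
  assumes "0 < c"
  shows "inv_fourier (conv_exp_remainder f) x = exp (inv_fourier f x) - 1 - inv_fourier f x"
proof -
  have [measurable]: "f \<in> borel_measurable lborel" using f by (simp add: band_limited_def)
  have "integrable lborel f"
    using f unfolding band_limited_def by (intro integrable_exp_weight_bounded[OF assms, of f B]) auto
  define u where "u = inv_fourier f x"
  define T where "T n \<xi> = conv_power f (Suc n) \<xi> / fact (n + 2)" for n \<xi>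
  have T_le: "norm (T n \<xi>) \<le> B * exp_weight c \<xi> * (R * B / pi) ^ Suc n" for n \<xi>
    unfolding T_def by (rule norm_conv_power_fact_le[OF f c R])
  have T: "integrable lborel (T n)" for n
  proof (rule integrable_exp_weight_bounded[OF assms])
    show "T n \<in> borel_measurable lborel" unfolding T_def[abs_def] by measurable
    show "norm (T n \<xi>) \<le> B * (R * B / pi) ^ Suc n * exp_weight c \<xi>" for \<xi>
      using T_le[of n \<xi>] by (simp only: mult_ac)
  qed
  have summable_T: "summable (\<lambda>n. norm (T n \<xi>))" for \<xi>
    by (rule summable_comparison_test'[OF sums_summable[OF geometric[of "B * exp_weight c \<xi>"]]])
      (simp only: real_norm_def abs_norm_cancel T_le)
  have "summable (\<lambda>n. B * (LINT \<xi>|lborel. exp_weight c \<xi>) * (R * B / pi) ^ Suc n)"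
    by (rule sums_summable[OF geometric])
  then have "summable (\<lambda>n. LINT \<xi>|lborel. norm (T n \<xi>))"
  proof (rule summable_comparison_test')
    show "norm (LINT \<xi>|lborel. norm (T n \<xi>)) \<le> B * (LINT \<xi>|lborel. exp_weight c \<xi>) * (R * B / pi) ^ Suc n"
      for n
    proof -
      have "0 \<le> (LINT \<xi>|lborel. norm (T n \<xi>))" by (intro integral_nonneg_AE AE_I2) simp
      moreover have "(LINT \<xi>|lborel. norm (T n \<xi>)) \<le> (LINT \<xi>|lborel. B * exp_weight c \<xi> * (R * B / pi) ^ Suc n)"
        using T integrable_exp_weight[OF assms] T_le by (intro integral_mono) simp_all
      ultimately show ?thesis by (simp add: mult_ac)
    qed
  qed
  then have "inv_fourier (conv_exp_remainder f) x = (\<Sum>n. inv_fourier (T n) x)"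
    unfolding conv_exp_remainder_def T_def[symmetric]
    by (rule inv_fourier_suminf[OF T summable_T])
  also have "\<dots> = (\<Sum>n. u ^ (n + 2) / fact (n + 2))"
  proof -
    have "inv_fourier (T n) x = u ^ (n + 2) / fact (n + 2)" for n
      unfolding T_def[abs_def] inv_fourier_divide inv_fourier_conv_power[OF \<open>integrable lborel f\<close>] u_def
      by (simp add: numeral_2_eq_2)
    then show ?thesis by simp
  qed
  also have "\<dots> = exp u - 1 - u"
    by (rule sums_unique[OF exp_minus_one_minus_sums, symmetric])
  finally show ?thesis unfolding u_def .
qed

end

section \<open>A contraction principle in a weighted sup norm\<close>

lemma weighted_geometric_convergence:
  fixes g :: "nat \<Rightarrow> 'a \<Rightarrow> 'b::banach"
  assumes step: "\<And>n \<xi>. norm (g (Suc n) \<xi> - g n \<xi>) \<le> C * (1/2) ^ n * w \<xi>"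
  obtains h where "\<And>\<xi>. (\<lambda>n. g n \<xi>) \<longlonglongrightarrow> h \<xi>"
    and "\<And>n \<xi>. norm (h \<xi> - g n \<xi>) \<le> 2 * C * (1/2) ^ n * w \<xi>"
proof
  have geometric: "(\<lambda>j. K * (1/2::real) ^ (j + n)) sums (K * (1/2) ^ n * 2)" for K n
    using sums_mult[OF geometric_sums[of "1/2::real"], of "K * (1/2) ^ n"] by (simp add: power_add mult_ac)
  have summable: "summable (\<lambda>n. g (Suc n) \<xi> - g n \<xi>)" for \<xi>
    using step by (intro summable_comparison_test'[OF sums_summable[OF geometric[of "C * w \<xi>" 0]]])
      (simp add: mult_ac)
  define h where "h \<xi> = g 0 \<xi> + (\<Sum>n. g (Suc n) \<xi> - g n \<xi>)" for \<xi>
  have partial_sums: "g 0 \<xi> + (\<Sum>i<n. g (Suc i) \<xi> - g i \<xi>) = g n \<xi>" for n \<xi>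
    using sum_lessThan_telescope[of "\<lambda>i. g i \<xi>" n] by simp
  show "(\<lambda>n. g n \<xi>) \<longlonglongrightarrow> h \<xi>" for \<xi>
    using tendsto_add[OF tendsto_const[of "g 0 \<xi>"] summable_LIMSEQ[OF summable[of \<xi>]]]
    unfolding partial_sums h_def .
  show "norm (h \<xi> - g n \<xi>) \<le> 2 * C * (1/2) ^ n * w \<xi>" for n \<xi>
  proof -
    have "h \<xi> - g n \<xi> = (\<Sum>j. g (Suc (j + n)) \<xi> - g (j + n) \<xi>)"
      using suminf_split_initial_segment[OF summable[of \<xi>], of n] partial_sums[of \<xi> n]
      unfolding h_def by (simp add: algebra_simps)
    also have "norm \<dots> \<le> (\<Sum>j. C * w \<xi> * (1/2) ^ (j + n))"
      by (rule norm_suminf_le) (use step sums_summable[OF geometric] in \<open>simp_all add: mult_ac\<close>)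
    also have "\<dots> = 2 * C * (1/2) ^ n * w \<xi>"
      using geometric[of "C * w \<xi>" n] by (simp add: sums_iff)
    finally show ?thesis .
  qed
qed

lemma weighted_contraction_fixed_point:
  fixes \<Phi> :: "('a \<Rightarrow> 'b::banach) \<Rightarrow> 'a \<Rightarrow> 'b" and w :: "'a \<Rightarrow> real"
  assumes P_zero: "P (\<lambda>_. 0)" and P_map: "\<And>h. P h \<Longrightarrow> P (\<Phi> h)"
    and P_bound: "\<And>h \<xi>. P h \<Longrightarrow> norm (h \<xi>) \<le> M * w \<xi>"
    and P_limit: "\<And>g h. (\<And>n. P (g n)) \<Longrightarrow> (\<And>\<xi>. (\<lambda>n. g n \<xi>) \<longlonglongrightarrow> h \<xi>) \<Longrightarrow> P h"
    and contraction: "\<And>h h' \<delta> \<xi>. P h \<Longrightarrow> P h' \<Longrightarrow> 0 \<le> \<delta> \<Longrightarrow> (\<And>\<xi>. norm (h \<xi> - h' \<xi>) \<le> \<delta> * w \<xi>)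
      \<Longrightarrow> norm (\<Phi> h \<xi> - \<Phi> h' \<xi>) \<le> \<delta> / 2 * w \<xi>"
    and M: "0 \<le> M" and w: "\<And>\<xi>. 0 \<le> w \<xi>"
  shows "\<exists>h. P h \<and> \<Phi> h = h"
proof -
  define g where "g n = (\<Phi> ^^ n) (\<lambda>_. 0)" for n
  have g_Suc: "g (Suc n) = \<Phi> (g n)" for n by (simp add: g_def)
  have P_g: "P (g n)" for n
    by (induction n) (simp_all add: g_def P_zero P_map)
  have step: "norm (g (Suc n) \<xi> - g n \<xi>) \<le> 2 * M * (1/2) ^ n * w \<xi>" for n \<xi>
  proof (induction n arbitrary: \<xi>)
    case 0
    have "norm (g 1 \<xi> - g 0 \<xi>) \<le> M * w \<xi>" using P_bound[OF P_g[of 1]] by (simp add: g_def)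
    also have "\<dots> \<le> 2 * M * w \<xi>" using M w[of \<xi>] by simp
    finally show ?case by simp
  next
    case (Suc n)
    have "norm (g (Suc (Suc n)) \<xi> - g (Suc n) \<xi>) = norm (\<Phi> (g (Suc n)) \<xi> - \<Phi> (g n) \<xi>)"
      by (simp only: g_Suc)
    also have "\<dots> \<le> 2 * M * (1/2) ^ n / 2 * w \<xi>"
      by (rule contraction[OF P_g P_g _ Suc.IH]) (use M in simp)
    finally show ?case by simp
  qed
  obtain h where g_tendsto: "\<And>\<xi>. (\<lambda>n. g n \<xi>) \<longlonglongrightarrow> h \<xi>"
    and tail: "\<And>n \<xi>. norm (h \<xi> - g n \<xi>) \<le> 2 * (2 * M) * (1/2) ^ n * w \<xi>"
    using weighted_geometric_convergence[of g "2 * M" w, OF step] by blast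
  have tail': "norm (h \<xi> - g n \<xi>) \<le> 4 * M * (1/2) ^ n * w \<xi>" for n \<xi>
    using tail by simp
  have "P h" using P_g g_tendsto by (rule P_limit)
  moreover have "\<Phi> h \<xi> = h \<xi>" for \<xi>
  proof -
    have "norm (\<Phi> h \<xi> - h \<xi>) \<le> 4 * M * w \<xi> * (1/2) ^ n" for n
    proof -
      have "norm (\<Phi> h \<xi> - h \<xi>) \<le> norm (\<Phi> h \<xi> - \<Phi> (g n) \<xi>) + norm (g (Suc n) \<xi> - h \<xi>)"
        using norm_triangle_ineq[of "\<Phi> h \<xi> - \<Phi> (g n) \<xi>" "g (Suc n) \<xi> - h \<xi>"] by (simp add: g_Suc)
      also have "\<dots> \<le> 4 * M * (1/2) ^ n / 2 * w \<xi> + 4 * M * (1/2) ^ Suc n * w \<xi>"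
        using tail'[where n = "Suc n"] M
        by (intro add_mono contraction \<open>P h\<close> P_g tail') (simp_all add: norm_minus_commute)
      finally show ?thesis by (simp add: algebra_simps)
    qed
    moreover have "(\<lambda>n. 4 * M * w \<xi> * (1/2::real) ^ n) \<longlonglongrightarrow> 4 * M * w \<xi> * 0"
      by (intro tendsto_intros LIMSEQ_power_zero) simp
    ultimately have "norm (\<Phi> h \<xi> - h \<xi>) \<le> 0"
      by (intro LIMSEQ_le_const[of "\<lambda>n. 4 * M * w \<xi> * (1/2) ^ n"]) auto
    then show ?thesis by simp
  qed
  ultimately show ?thesis by blast
qed

section \<open>The fixed-point equation on the Fourier side\<close>

locale band_limited_equation =
  fixes lam \<Gamma> a :: real and b :: "real \<Rightarrow> real" and p_hat :: "real \<Rightarrow> complex"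
  assumes lam_pos: "lam > 0" and \<Gamma>_pos: "\<Gamma> > 0" and a_pos: "a > 0"
    and lam_large: "lam > 6 * max \<Gamma> (1 / a)"
    and b_measurable: "b \<in> borel_measurable borel" and b_range: "\<And>\<xi>. 0 \<le> b \<xi> \<and> b \<xi> \<le> 1"
    and b_vanishes: "\<And>\<xi>. \<bar>\<xi>\<bar> \<ge> sqrt 2 * lam \<Longrightarrow> b \<xi> = 0"
    and p_hat_measurable: "p_hat \<in> borel_measurable borel"
    and p_hat_bound: "\<And>\<xi>. norm (p_hat \<xi>) \<le> \<Gamma> * exp_weight a \<xi>"
begin

definition decay :: real where
  "decay = a - 1 / lam"

text \<open>The factor gained by each convolution with \<^term>\<open>tb_hat h\<close>, \<open>h\<close> in the ball: twice the cutoff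
  \<open>sqrt 2 * lam\<close> of \<^term>\<open>b\<close> times the bound \<open>\<Gamma> / lam\<^sup>2\<close> of \<^term>\<open>tb_hat h\<close>, divided by \<open>2 * pi\<close>.\<close>

definition ratio :: real where
  "ratio = sqrt 2 * lam * (\<Gamma> / lam\<^sup>2) / pi"

definition multiplier :: "real \<Rightarrow> real" where
  "multiplier \<xi> = b \<xi> / (4 * lam\<^sup>2 - \<xi>\<^sup>2)"

text \<open>For \<open>\<sigma> = inv_fourier h\<close>, \<^term>\<open>tb_hat h\<close>, \<^term>\<open>tb_deriv_hat h\<close> and \<^term>\<open>S_hat h\<close> are the
  Fourier transforms of \<open>T\<^sub>b \<sigma>\<close>, \<open>(T\<^sub>b \<sigma>)'\<close> and \<open>S[T\<^sub>b \<sigma>]\<close>: the square becomes a convolution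
  and \<open>e\<^sup>u - 1 - u\<close> the series \<^const>\<open>conv_exp_remainder\<close>.\<close>

definition tb_hat :: "(real \<Rightarrow> complex) \<Rightarrow> real \<Rightarrow> complex" where
  "tb_hat h \<xi> = h \<xi> * complex_of_real (multiplier \<xi>)"

definition tb_deriv_hat :: "(real \<Rightarrow> complex) \<Rightarrow> real \<Rightarrow> complex" where
  "tb_deriv_hat h \<xi> = \<i> * \<xi> * tb_hat h \<xi>"

definition S_hat :: "(real \<Rightarrow> complex) \<Rightarrow> real \<Rightarrow> complex" where
  "S_hat h \<xi> = conv_fun (tb_deriv_hat h) (tb_deriv_hat h) \<xi> / (2 * pi) / 4
    - 4 * lam\<^sup>2 * conv_exp_remainder (tb_hat h) \<xi>"

definition \<Phi> :: "(real \<Rightarrow> complex) \<Rightarrow> real \<Rightarrow> complex" where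
  "\<Phi> h \<xi> = p_hat \<xi> + S_hat h \<xi>"

definition in_ball :: "(real \<Rightarrow> complex) \<Rightarrow> bool" where
  "in_ball h \<longleftrightarrow> h \<in> borel_measurable borel \<and> (\<forall>\<xi>. norm (h \<xi>) \<le> 2 * \<Gamma> * exp_weight decay \<xi>)"

lemma decay_pos: "decay > 0" and decay_le: "decay \<le> a"
proof -
  have "1 / a < lam / 6" using lam_large by (simp add: max_def split: if_splits)
  then show "decay > 0" using a_pos lam_pos by (simp add: decay_def field_simps)
  show "decay \<le> a" using lam_pos by (simp add: decay_def)
qed

lemma ratio_nonneg: "0 \<le> ratio"
  using lam_pos \<Gamma>_pos by (simp add: ratio_def)

lemma ratio_small: "ratio \<le> 1 / 12"
proof -
  have "\<Gamma> / lam < 1 / 6" using lam_large lam_pos by (simp add: field_simps max_def split: if_splits)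
  moreover have "sqrt 2 < 3 / 2" by (rule real_less_lsqrt) (auto simp: power2_eq_square)
  ultimately have "sqrt 2 * (\<Gamma> / lam) \<le> 3 / 2 * (1 / 6)"
    using \<Gamma>_pos lam_pos by (intro mult_mono) auto
  then have "sqrt 2 * (\<Gamma> / lam) / pi \<le> 1 / 4 / pi" by (rule divide_right_mono[THEN order_trans]) simp_all
  also have "\<dots> \<le> 1 / 12" using pi_gt3 by (simp add: field_simps)
  finally show ?thesis using lam_pos by (simp add: ratio_def power2_eq_square)
qed

lemma ratio_quotient_le: "ratio / (1 - ratio) \<le> 1 / 11"
  using ratio_small ratio_nonneg by (simp add: field_simps)

lemma multiplier_eq_0: "sqrt 2 * lam \<le> \<bar>\<xi>\<bar> \<Longrightarrow> multiplier \<xi> = 0"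
  by (simp add: multiplier_def b_vanishes)

lemma abs_multiplier_le: "\<bar>multiplier \<xi>\<bar> \<le> 1 / (2 * lam\<^sup>2)"
proof (cases "sqrt 2 * lam \<le> \<bar>\<xi>\<bar>")
  case False
  then have "\<bar>\<xi>\<bar>\<^sup>2 < (sqrt 2 * lam)\<^sup>2" by (intro power_strict_mono) auto
  then have denominator: "2 * lam\<^sup>2 < 4 * lam\<^sup>2 - \<xi>\<^sup>2" by (simp add: power_mult_distrib)
  have "0 < lam\<^sup>2" using lam_pos by simp
  from denominator have pos: "0 < 4 * lam\<^sup>2 - \<xi>\<^sup>2" using \<open>0 < lam\<^sup>2\<close> by linarith
  have "\<bar>multiplier \<xi>\<bar> = b \<xi> / (4 * lam\<^sup>2 - \<xi>\<^sup>2)"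
    unfolding multiplier_def abs_divide abs_of_pos[OF pos] using b_range[of \<xi>] by simp
  also have "\<dots> \<le> 1 / (4 * lam\<^sup>2 - \<xi>\<^sup>2)"
    using b_range[of \<xi>] pos by (intro divide_right_mono) auto
  also have "\<dots> \<le> 1 / (2 * lam\<^sup>2)"
    using denominator \<open>0 < lam\<^sup>2\<close> pos by (intro divide_left_mono) simp_all
  finally show ?thesis .
qed (simp add: multiplier_eq_0 lam_pos)

lemma multiplier_measurable [measurable]: "multiplier \<in> borel_measurable borel"
  using b_measurable unfolding multiplier_def[abs_def] by measurable

lemma tb_hat_diff: "tb_hat h \<xi> - tb_hat h' \<xi> = tb_hat (\<lambda>\<xi>. h \<xi> - h' \<xi>) \<xi>"
  by (simp add: tb_hat_def left_diff_distrib)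

lemma tb_deriv_hat_diff: "tb_deriv_hat h \<xi> - tb_deriv_hat h' \<xi> = tb_deriv_hat (\<lambda>\<xi>. h \<xi> - h' \<xi>) \<xi>"
  by (simp add: tb_deriv_hat_def tb_hat_def algebra_simps)

lemma band_limited_tb_hat:
  assumes [measurable]: "h \<in> borel_measurable lborel" and h: "\<And>\<xi>. norm (h \<xi>) \<le> K * exp_weight decay \<xi>"
  shows "band_limited (sqrt 2 * lam) decay (K / (2 * lam\<^sup>2)) (tb_hat h)"
    and "band_limited (sqrt 2 * lam) decay (sqrt 2 * lam * (K / (2 * lam\<^sup>2))) (tb_deriv_hat h)"
proof -
  have "0 \<le> K" by (rule weight_bound_nonneg[OF h])
  have tb: "norm (tb_hat h \<xi>) \<le> K / (2 * lam\<^sup>2) * exp_weight decay \<xi>" for \<xi>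
  proof -
    have "norm (tb_hat h \<xi>) \<le> (K * exp_weight decay \<xi>) * (1 / (2 * lam\<^sup>2))"
      unfolding tb_hat_def norm_mult norm_of_real
      by (intro mult_mono h abs_multiplier_le) (use \<open>0 \<le> K\<close> exp_weight_pos[of decay \<xi>] in auto)
    then show ?thesis by simp
  qed
  have vanish: "tb_hat h \<xi> = 0" if "sqrt 2 * lam < \<bar>\<xi>\<bar>" for \<xi>
    using that by (simp add: tb_hat_def multiplier_eq_0)
  show "band_limited (sqrt 2 * lam) decay (K / (2 * lam\<^sup>2)) (tb_hat h)"
    unfolding band_limited_def tb_hat_def[abs_def] using tb vanish by (auto simp: tb_hat_def)
  have "norm (tb_deriv_hat h \<xi>) \<le> sqrt 2 * lam * (K / (2 * lam\<^sup>2)) * exp_weight decay \<xi>" for \<xi>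
  proof (cases "sqrt 2 * lam < \<bar>\<xi>\<bar>")
    case False
    then have "\<bar>\<xi>\<bar> * norm (tb_hat h \<xi>) \<le> sqrt 2 * lam * (K / (2 * lam\<^sup>2) * exp_weight decay \<xi>)"
      by (intro mult_mono tb) auto
    then show ?thesis by (simp add: tb_deriv_hat_def norm_mult mult_ac)
  qed (use \<open>0 \<le> K\<close> lam_pos vanish in \<open>simp add: tb_deriv_hat_def less_imp_le[OF exp_weight_pos]\<close>)
  then show "band_limited (sqrt 2 * lam) decay (sqrt 2 * lam * (K / (2 * lam\<^sup>2))) (tb_deriv_hat h)"
    unfolding band_limited_def using vanish
    by (auto simp: tb_deriv_hat_def[abs_def] tb_hat_def[abs_def])
qed

lemma in_ball_measurable: "in_ball h \<Longrightarrow> h \<in> borel_measurable lborel"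
  by (simp add: in_ball_def)

lemma in_ball_bound: "in_ball h \<Longrightarrow> norm (h \<xi>) \<le> 2 * \<Gamma> * exp_weight decay \<xi>"
  by (simp add: in_ball_def)

lemma in_ball_integrable: "in_ball h \<Longrightarrow> integrable lborel h"
  by (rule integrable_exp_weight_bounded[OF decay_pos in_ball_measurable in_ball_bound])

lemma ratio_less_one: "sqrt 2 * lam * (\<Gamma> / lam\<^sup>2) / pi < 1"
  using ratio_small unfolding ratio_def by linarith

lemma band_limited_tb_hat_in_ball:
  assumes "in_ball h"
  shows "band_limited (sqrt 2 * lam) decay (\<Gamma> / lam\<^sup>2) (tb_hat h)"
    and "band_limited (sqrt 2 * lam) decay (sqrt 2 * lam * (\<Gamma> / lam\<^sup>2)) (tb_deriv_hat h)"
  using band_limited_tb_hat[OF in_ball_measurable[OF assms] in_ball_bound[OF assms]] by simp_all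

lemma tb_hat_measurable [measurable]:
  assumes [measurable]: "h \<in> borel_measurable lborel"
  shows "tb_hat h \<in> borel_measurable lborel"
  unfolding tb_hat_def[abs_def] by measurable

lemma tb_deriv_hat_measurable [measurable]:
  assumes [measurable]: "h \<in> borel_measurable lborel"
  shows "tb_deriv_hat h \<in> borel_measurable lborel"
  unfolding tb_deriv_hat_def[abs_def] by measurable

lemma band_limited_tb_hat_diff:
  assumes h: "in_ball h" and h': "in_ball h'"
    and diff: "\<And>\<xi>. norm (h \<xi> - h' \<xi>) \<le> \<delta> * exp_weight decay \<xi>"
  shows "band_limited (sqrt 2 * lam) decay (\<delta> / (2 * lam\<^sup>2)) (\<lambda>\<xi>. tb_hat h \<xi> - tb_hat h' \<xi>)"
    and "band_limited (sqrt 2 * lam) decay (sqrt 2 * lam * (\<delta> / (2 * lam\<^sup>2)))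
      (\<lambda>\<xi>. tb_deriv_hat h \<xi> - tb_deriv_hat h' \<xi>)"
proof -
  have [measurable]: "h \<in> borel_measurable lborel" "h' \<in> borel_measurable lborel"
    using in_ball_measurable h h' by auto
  show "band_limited (sqrt 2 * lam) decay (\<delta> / (2 * lam\<^sup>2)) (\<lambda>\<xi>. tb_hat h \<xi> - tb_hat h' \<xi>)"
    and "band_limited (sqrt 2 * lam) decay (sqrt 2 * lam * (\<delta> / (2 * lam\<^sup>2)))
      (\<lambda>\<xi>. tb_deriv_hat h \<xi> - tb_deriv_hat h' \<xi>)"
    unfolding tb_hat_diff tb_deriv_hat_diff by (rule band_limited_tb_hat[OF _ diff], measurable)+
qed

lemma norm_conv_tb_deriv_hat_diff_le:
  assumes h: "in_ball h" and h': "in_ball h'" and "0 \<le> \<delta>"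
    and diff: "\<And>\<xi>. norm (h \<xi> - h' \<xi>) \<le> \<delta> * exp_weight decay \<xi>"
  shows "norm ((conv_fun (tb_deriv_hat h) (tb_deriv_hat h) \<xi>
    - conv_fun (tb_deriv_hat h') (tb_deriv_hat h') \<xi>) / (2 * pi) / 4) \<le> \<delta> / 24 * exp_weight decay \<xi>"
proof -
  note tb = band_limited_tb_hat_in_ball(2)[OF h] and tb' = band_limited_tb_hat_in_ball(2)[OF h']
    and tb_diff = band_limited_tb_hat_diff(2)[OF h h' diff]
  have [measurable]: "h \<in> borel_measurable lborel" "h' \<in> borel_measurable lborel"
    using in_ball_measurable h h' by auto
  have c: "0 \<le> decay" and R: "0 \<le> sqrt 2 * lam" using decay_pos lam_pos by simp_all
  have "conv_fun (tb_deriv_hat h) (tb_deriv_hat h) \<xi> - conv_fun (tb_deriv_hat h') (tb_deriv_hat h') \<xi>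
      = conv_fun (\<lambda>\<eta>. tb_deriv_hat h \<eta> - tb_deriv_hat h' \<eta>) (tb_deriv_hat h) \<xi>
        + conv_fun (tb_deriv_hat h') (\<lambda>\<zeta>. tb_deriv_hat h \<zeta> - tb_deriv_hat h' \<zeta>) \<xi>"
  proof (rule conv_fun_diff)
    show "integrable lborel (\<lambda>\<eta>. tb_deriv_hat h \<eta> * tb_deriv_hat h (\<xi> - \<eta>))"
      by (rule conv_fun_band_limited_bound(1)[OF tb _ band_limited_bound[OF tb] c R]) measurable
    show "integrable lborel (\<lambda>\<eta>. tb_deriv_hat h' \<eta> * tb_deriv_hat h' (\<xi> - \<eta>))"
      by (rule conv_fun_band_limited_bound(1)[OF tb' _ band_limited_bound[OF tb'] c R]) measurable
    show "integrable lborel (\<lambda>\<eta>. tb_deriv_hat h' \<eta> * tb_deriv_hat h (\<xi> - \<eta>))"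
      by (rule conv_fun_band_limited_bound(1)[OF tb' _ band_limited_bound[OF tb] c R]) measurable
  qed
  also have "norm \<dots> \<le> 2 * (sqrt 2 * lam) * (sqrt 2 * lam * (\<delta> / (2 * lam\<^sup>2)))
        * (sqrt 2 * lam * (\<Gamma> / lam\<^sup>2)) * exp_weight decay \<xi>
      + 2 * (sqrt 2 * lam) * (sqrt 2 * lam * (\<Gamma> / lam\<^sup>2))
        * (sqrt 2 * lam * (\<delta> / (2 * lam\<^sup>2))) * exp_weight decay \<xi>"
    by (intro order.trans[OF norm_triangle_ineq] add_mono
        conv_fun_band_limited_bound(2)[OF tb_diff _ band_limited_bound[OF tb] c R]
        conv_fun_band_limited_bound(2)[OF tb' _ band_limited_bound[OF tb_diff] c R]) measurable
  also have "\<dots> = 4 * pi * (ratio * \<delta> * exp_weight decay \<xi>)"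
    using lam_pos by (simp add: ratio_def field_simps power2_eq_square)
  finally have "norm (conv_fun (tb_deriv_hat h) (tb_deriv_hat h) \<xi> - conv_fun (tb_deriv_hat h') (tb_deriv_hat h') \<xi>)
      \<le> 4 * pi * (ratio * \<delta> * exp_weight decay \<xi>)" .
  moreover have "norm (z / (2 * pi) / 4) = norm z / (4 * pi) / 2" for z :: complex
    by (simp add: norm_divide)
  ultimately have "norm ((conv_fun (tb_deriv_hat h) (tb_deriv_hat h) \<xi>
      - conv_fun (tb_deriv_hat h') (tb_deriv_hat h') \<xi>) / (2 * pi) / 4) \<le> ratio * \<delta> * exp_weight decay \<xi> / 2"
    by (simp add: divide_le_eq mult_ac)
  also have "\<dots> \<le> \<delta> / 24 * exp_weight decay \<xi>"
    using ratio_small \<open>0 \<le> \<delta>\<close> exp_weight_pos[of decay \<xi>]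
    by (simp add: field_simps mult_right_mono mult_left_mono)
  finally show ?thesis .
qed

lemma norm_exp_remainder_tb_hat_diff_le:
  assumes h: "in_ball h" and h': "in_ball h'" and "0 \<le> \<delta>"
    and diff: "\<And>\<xi>. norm (h \<xi> - h' \<xi>) \<le> \<delta> * exp_weight decay \<xi>"
  shows "norm (4 * lam\<^sup>2 * conv_exp_remainder (tb_hat h) \<xi> - 4 * lam\<^sup>2 * conv_exp_remainder (tb_hat h') \<xi>)
    \<le> 2 * \<delta> / 11 * exp_weight decay \<xi>"
proof -
  have E: "norm (conv_exp_remainder (tb_hat h) \<xi> - conv_exp_remainder (tb_hat h') \<xi>)
      \<le> \<delta> / (2 * lam\<^sup>2) * exp_weight decay \<xi> * ratio / (1 - ratio)"
    using conv_exp_remainder_lipschitz[OF band_limited_tb_hat_in_ball(1)[OF h] _ _ ratio_less_one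
        band_limited_tb_hat_in_ball(1)[OF h'] band_limited_tb_hat_diff(1)[OF h h' diff]]
      decay_pos lam_pos
    unfolding ratio_def by simp
  have "norm (4 * lam\<^sup>2 * conv_exp_remainder (tb_hat h) \<xi> - 4 * lam\<^sup>2 * conv_exp_remainder (tb_hat h') \<xi>)
      = 4 * lam\<^sup>2 * norm (conv_exp_remainder (tb_hat h) \<xi> - conv_exp_remainder (tb_hat h') \<xi>)"
    by (simp add: norm_mult norm_power flip: right_diff_distrib)
  also have "\<dots> \<le> 4 * lam\<^sup>2 * (\<delta> / (2 * lam\<^sup>2) * exp_weight decay \<xi> * ratio / (1 - ratio))"
    by (rule mult_left_mono[OF E]) simp
  also have "\<dots> = 2 * \<delta> * (ratio / (1 - ratio)) * exp_weight decay \<xi>"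
    using lam_pos ratio_small by (simp add: field_simps)
  also have "\<dots> \<le> 2 * \<delta> * (1 / 11) * exp_weight decay \<xi>"
    using ratio_quotient_le \<open>0 \<le> \<delta>\<close> exp_weight_pos[of decay \<xi>]
    by (intro mult_right_mono mult_left_mono) simp_all
  finally show ?thesis by simp
qed

lemma S_hat_lipschitz:
  assumes "in_ball h" "in_ball h'" "0 \<le> \<delta>"
    and "\<And>\<xi>. norm (h \<xi> - h' \<xi>) \<le> \<delta> * exp_weight decay \<xi>"
  shows "norm (S_hat h \<xi> - S_hat h' \<xi>) \<le> \<delta> / 2 * exp_weight decay \<xi>"
proof -
  have "S_hat h \<xi> - S_hat h' \<xi>
      = (conv_fun (tb_deriv_hat h) (tb_deriv_hat h) \<xi> - conv_fun (tb_deriv_hat h') (tb_deriv_hat h') \<xi>) / (2 * pi) / 4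
        - (4 * lam\<^sup>2 * conv_exp_remainder (tb_hat h) \<xi> - 4 * lam\<^sup>2 * conv_exp_remainder (tb_hat h') \<xi>)"
    unfolding S_hat_def by (simp add: diff_divide_distrib)
  also have "norm \<dots> \<le> \<delta> / 24 * exp_weight decay \<xi> + 2 * \<delta> / 11 * exp_weight decay \<xi>"
    by (rule order.trans[OF norm_triangle_ineq4 add_mono[OF norm_conv_tb_deriv_hat_diff_le
          norm_exp_remainder_tb_hat_diff_le]]) (use assms in simp_all)
  also have "\<dots> \<le> \<delta> / 2 * exp_weight decay \<xi>"
    using \<open>0 \<le> \<delta>\<close> exp_weight_pos[of decay \<xi>] by (simp add: field_simps)
  finally show ?thesis .
qed

lemma in_ball_zero: "in_ball (\<lambda>_. 0)"
  using \<Gamma>_pos exp_weight_pos[of decay] by (simp add: in_ball_def less_imp_le)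

lemma S_hat_zero: "S_hat (\<lambda>_. 0) = (\<lambda>_. 0)"
  by (simp add: S_hat_def tb_deriv_hat_def[abs_def] tb_hat_def[abs_def] conv_fun_zero_left
      conv_exp_remainder_zero fun_eq_iff)

lemma norm_S_hat_le:
  assumes "in_ball h"
  shows "norm (S_hat h \<xi>) \<le> \<Gamma> * exp_weight decay \<xi>"
  using S_hat_lipschitz[OF assms in_ball_zero, of "2 * \<Gamma>" \<xi>] in_ball_bound[OF assms] \<Gamma>_pos
  by (simp add: S_hat_zero)

lemma S_hat_measurable:
  assumes h: "in_ball h"
  shows "S_hat h \<in> borel_measurable lborel"
proof -
  have [measurable]: "h \<in> borel_measurable lborel" using in_ball_measurable[OF h] .
  have "band_limited (sqrt 2 * lam) decay (\<Gamma> / lam\<^sup>2) (tb_hat h)"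
    by (rule band_limited_tb_hat_in_ball(1)[OF h])
  then have [measurable]: "conv_exp_remainder (tb_hat h) \<in> borel_measurable lborel"
    by (rule conv_exp_remainder_measurable[OF _ _ _ ratio_less_one]) (use decay_pos lam_pos in auto)
  show ?thesis unfolding S_hat_def[abs_def] by measurable
qed

lemma in_ball_\<Phi>:
  assumes h: "in_ball h"
  shows "in_ball (\<Phi> h)"
  unfolding in_ball_def
proof (intro conjI allI)
  have [measurable]: "S_hat h \<in> borel_measurable lborel" by (rule S_hat_measurable[OF h])
  show "\<Phi> h \<in> borel_measurable borel"
    using p_hat_measurable unfolding \<Phi>_def[abs_def] by measurable
  fix \<xi>
  have "norm (\<Phi> h \<xi>) \<le> \<Gamma> * exp_weight a \<xi> + \<Gamma> * exp_weight decay \<xi>"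
    unfolding \<Phi>_def by (rule order.trans[OF norm_triangle_ineq add_mono[OF p_hat_bound norm_S_hat_le[OF h]]])
  also have "\<dots> \<le> \<Gamma> * exp_weight decay \<xi> + \<Gamma> * exp_weight decay \<xi>"
    using \<Gamma>_pos exp_weight_antimono[OF decay_le] by (simp add: mult_left_mono)
  finally show "norm (\<Phi> h \<xi>) \<le> 2 * \<Gamma> * exp_weight decay \<xi>" by simp
qed

lemma in_ball_limit:
  assumes "\<And>n. in_ball (g n)" and "\<And>\<xi>. (\<lambda>n. g n \<xi>) \<longlonglongrightarrow> h \<xi>"
  shows "in_ball h"
  unfolding in_ball_def
proof (intro conjI allI)
  show "h \<in> borel_measurable borel"
    by (rule borel_measurable_LIMSEQ_metric[of g]) (use assms in \<open>auto simp: in_ball_def\<close>)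
  show "norm (h \<xi>) \<le> 2 * \<Gamma> * exp_weight decay \<xi>" for \<xi>
    by (rule LIMSEQ_le_const2[OF tendsto_norm[OF assms(2)]]) (use assms(1) in \<open>auto simp: in_ball_def\<close>)
qed

lemma in_ball_fixed_point_exists: "\<exists>h. in_ball h \<and> \<Phi> h = h"
proof (rule weighted_contraction_fixed_point[where M = "2 * \<Gamma>" and w = "exp_weight decay"])
  show "in_ball (\<lambda>_. 0)" by (rule in_ball_zero)
  show "\<And>\<xi>. 0 \<le> exp_weight decay \<xi>" by (simp add: less_imp_le[OF exp_weight_pos])
  show "norm (\<Phi> h \<xi> - \<Phi> h' \<xi>) \<le> \<delta> / 2 * exp_weight decay \<xi>"
    if "in_ball h" "in_ball h'" "0 \<le> \<delta>" "\<And>\<xi>. norm (h \<xi> - h' \<xi>) \<le> \<delta> * exp_weight decay \<xi>"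
    for h h' \<delta> \<xi>
    using S_hat_lipschitz[OF that] by (simp add: \<Phi>_def)
  show "in_ball h" if "\<And>n. in_ball (g n)" "\<And>\<xi>. (\<lambda>n. g n \<xi>) \<longlonglongrightarrow> h \<xi>" for g h
    using that by (rule in_ball_limit)
qed (use in_ball_\<Phi> in_ball_bound \<Gamma>_pos in auto)

lemma p_hat_integrable: "integrable lborel p_hat"
  using a_pos p_hat_measurable p_hat_bound by (intro integrable_exp_weight_bounded) auto

lemma band_limited_integrable: "band_limited R decay B f \<Longrightarrow> integrable lborel f"
  unfolding band_limited_def by (intro integrable_exp_weight_bounded[OF decay_pos]) auto

lemma inv_fourier_tb_hat_has_vector_derivative:
  assumes h: "in_ball h"
  shows "(inv_fourier (tb_hat h) has_vector_derivative inv_fourier (tb_deriv_hat h) x) (at x)"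
proof -
  note tb = band_limited_tb_hat_in_ball[OF h]
  have [measurable]: "h \<in> borel_measurable lborel" using in_ball_measurable[OF h] .
  have "integrable lborel (\<lambda>\<xi>. \<xi> * tb_hat h \<xi>)"
  proof (rule Bochner_Integration.integrable_bound[OF band_limited_integrable[OF tb(2)]])
    show "AE \<xi> in lborel. norm (\<xi> * tb_hat h \<xi>) \<le> norm (tb_deriv_hat h \<xi>)"
      by (intro AE_I2) (simp add: tb_deriv_hat_def norm_mult)
  qed measurable
  from inv_fourier_has_vector_derivative[OF band_limited_integrable[OF tb(1)] this, of x]
  show ?thesis by (simp add: tb_deriv_hat_def[abs_def])
qed

lemma inv_fourier_S_hat:
  assumes h: "in_ball h"
  shows "inv_fourier (S_hat h) x = S_op lam (inv_fourier (tb_hat h)) x"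
proof -
  note tb = band_limited_tb_hat_in_ball[OF h]
  have [measurable]: "h \<in> borel_measurable lborel" using in_ball_measurable[OF h] .
  have c: "0 \<le> decay" and R: "0 \<le> sqrt 2 * lam" using decay_pos lam_pos by simp_all
  define u where "u = inv_fourier (tb_hat h) x"
  define A where "A \<xi> = conv_fun (tb_deriv_hat h) (tb_deriv_hat h) \<xi> / (2 * pi)" for \<xi>
  have A: "integrable lborel A"
    unfolding A_def using integrable_conv_fun[OF band_limited_integrable[OF tb(2)] band_limited_integrable[OF tb(2)]]
    by simp
  have E: "integrable lborel (conv_exp_remainder (tb_hat h))"
    by (rule integrable_conv_exp_remainder[OF tb(1) c R ratio_less_one decay_pos])
  have "inv_fourier (S_hat h) x
      = inv_fourier (\<lambda>\<xi>. A \<xi> / 4) x - inv_fourier (\<lambda>\<xi>. 4 * lam\<^sup>2 * conv_exp_remainder (tb_hat h) \<xi>) x"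
    unfolding S_hat_def[abs_def] A_def[symmetric] using A E by (intro inv_fourier_diff) auto
  also have "inv_fourier (\<lambda>\<xi>. A \<xi> / 4) x = (inv_fourier (tb_deriv_hat h) x)\<^sup>2 / 4"
  proof -
    have "inv_fourier A x = inv_fourier (tb_deriv_hat h) x * inv_fourier (tb_deriv_hat h) x"
      unfolding A_def[abs_def]
      by (rule inv_fourier_conv_fun[OF band_limited_integrable[OF tb(2)] band_limited_integrable[OF tb(2)], symmetric])
    then show ?thesis by (simp add: inv_fourier_divide power2_eq_square)
  qed
  also have "inv_fourier (\<lambda>\<xi>. 4 * lam\<^sup>2 * conv_exp_remainder (tb_hat h) \<xi>) x = 4 * lam\<^sup>2 * (exp u - 1 - u)"
    unfolding inv_fourier_mult_left u_def
    by (simp add: inv_fourier_conv_exp_remainder[OF tb(1) c R ratio_less_one decay_pos])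
  also have "inv_fourier (tb_deriv_hat h) x = vector_derivative (inv_fourier (tb_hat h)) (at x)"
    by (rule vector_derivative_at[OF inv_fourier_tb_hat_has_vector_derivative[OF h], symmetric])
  finally show ?thesis unfolding S_op_def u_def by simp
qed

lemma inv_fourier_fixed_point:
  assumes h: "in_ball h" and fixed: "\<Phi> h = h"
  shows "inv_fourier h x = S_op lam (inv_fourier (tb_hat h)) x + inv_fourier p_hat x"
proof -
  have "integrable lborel (S_hat h)"
    by (rule integrable_exp_weight_bounded[OF decay_pos S_hat_measurable[OF h] norm_S_hat_le[OF h]])
  then have "inv_fourier (\<Phi> h) x = inv_fourier p_hat x + inv_fourier (S_hat h) x"
    unfolding \<Phi>_def[abs_def] by (rule inv_fourier_add[OF p_hat_integrable])
  then show ?thesis using fixed inv_fourier_S_hat[OF h] by simp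
qed

lemma C_inf_inv_fourier_in_ball: "in_ball h \<Longrightarrow> C_inf (inv_fourier h)"
proof (rule C_inf_inv_fourier[OF in_ball_measurable])
  fix k assume h: "in_ball h"
  show "integrable lborel (\<lambda>\<xi>. \<bar>\<xi>\<bar> ^ k * norm (h \<xi>))"
  proof (rule Bochner_Integration.integrable_bound)
    show "integrable lborel (\<lambda>\<xi>. 2 * \<Gamma> * (\<bar>\<xi>\<bar> ^ k * exp (- decay * \<bar>\<xi>\<bar>)))"
      using integrable_abs_power_exp_neg_abs[OF decay_pos] by simp
    show "AE \<xi> in lborel. norm (\<bar>\<xi>\<bar> ^ k * norm (h \<xi>)) \<le> norm (2 * \<Gamma> * (\<bar>\<xi>\<bar> ^ k * exp (- decay * \<bar>\<xi>\<bar>)))"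
      using in_ball_bound[OF h] \<Gamma>_pos
      by (intro AE_I2) (simp add: exp_weight_def abs_mult mult_left_mono mult.left_commute)
  qed (use in_ball_measurable[OF h] in measurable)
qed

lemma L2_inv_fourier_in_ball:
  assumes h: "in_ball h"
  shows "L2 (inv_fourier h)"
proof (rule L2_inv_fourier[OF in_ball_integrable[OF h]])
  show "norm (h \<xi>) \<le> 2 * \<Gamma>" for \<xi>
    using order_trans[OF in_ball_bound[OF h] mult_left_le[OF exp_weight_le_one]] decay_pos \<Gamma>_pos
    by simp
qed

end

theorem theorem7p6:
  fixes lam \<Gamma> a :: real and b :: "real \<Rightarrow> real" and p :: "real \<Rightarrow> real"
  assumes "lam > 0" and "\<Gamma> > 0" and "a > 0" and "lam > 6 * max \<Gamma> (1 / a)"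
    and "C_inf b" and "\<forall>\<xi>. 0 \<le> b \<xi> \<and> b \<xi> \<le> 1"
    and "\<forall>\<xi>. \<bar>\<xi>\<bar> \<le> lam \<longrightarrow> b \<xi> = 1"
    and "\<forall>\<xi>. \<bar>\<xi>\<bar> \<ge> sqrt 2 * lam \<longrightarrow> b \<xi> = 0"
    and "integrable lborel p" and "continuous_on UNIV p"
    and "\<forall>\<xi>. cmod (fourier (\<lambda>x. complex_of_real (p x)) \<xi>) \<le> \<Gamma> * exp (- a * \<bar>\<xi>\<bar>)"
  shows "\<exists>(\<sigma>::real \<Rightarrow> complex) \<sigma>h.
           L2 \<sigma> \<and> C_inf \<sigma> \<and> integrable lborel \<sigma>h \<and> (\<forall>x. \<sigma> x = inv_fourier \<sigma>h x) \<and>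
           (\<forall>x. Tb_hat lam b \<sigma>h differentiable (at x)) \<and>
           (\<forall>x. \<sigma> x = S_op lam (Tb_hat lam b \<sigma>h) x + complex_of_real (p x)) \<and>
           (\<forall>\<xi>. cmod (\<sigma>h \<xi>) \<le> 2 * \<Gamma> * exp (- (a - 1 / lam) * \<bar>\<xi>\<bar>))"
proof -
  define P where "P = (\<lambda>x. complex_of_real (p x))"
  have P: "integrable lborel P" and P_cont: "isCont P x" for x
    using assms(9,10) by (auto simp: P_def continuous_on_eq_continuous_at intro: continuous_intros)
  have "b \<in> borel_measurable borel"
    using C_inf_imp_continuous[OF assms(5)] by (rule borel_measurable_continuous_onI)
  then interpret band_limited_equation lam \<Gamma> a b "fourier P"
    using assms(1-4,6,8,11) P by unfold_locales (auto simp: P_def exp_weight_def)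
  obtain h where h: "in_ball h" and fixed: "\<Phi> h = h"
    using in_ball_fixed_point_exists by blast
  have Tb: "Tb_hat lam b h = inv_fourier (tb_hat h)"
    by (simp add: Tb_hat_def tb_hat_def[abs_def] multiplier_def fun_eq_iff)
  have "inv_fourier h x = S_op lam (Tb_hat lam b h) x + complex_of_real (p x)" for x
    using inv_fourier_fixed_point[OF h fixed] fourier_inversion[OF P P_cont p_hat_integrable]
    by (simp add: Tb P_def)
  moreover have "Tb_hat lam b h differentiable (at x)" for x
    unfolding Tb using inv_fourier_tb_hat_has_vector_derivative[OF h] by (rule differentiableI_vector)
  moreover have "cmod (h \<xi>) \<le> 2 * \<Gamma> * exp (- (a - 1 / lam) * \<bar>\<xi>\<bar>)" for \<xi>
    using in_ball_bound[OF h] by (simp add: exp_weight_def decay_def)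
  ultimately show ?thesis
    using L2_inv_fourier_in_ball[OF h] C_inf_inv_fourier_in_ball[OF h] in_ball_integrable[OF h]
    by blast
qed

end
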